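(* Let $n\geqslant 1$, let $P=\mathcal F(\Delta^{n-1})$ be the poset of nonempty subsets of $[n]$ ordered by inclusion, and let $D$ be a diagram on $P^*$ with values in finite sets whose associated sheaf $\mathcal D$ on $X_{P^*}$ is inhabited and flabby. Then the geometric realization $|P_D|$ of the inflation is homotopy equivalent to a wedge of $(n-1)$-dimensional spheres.
   Context: All posets are finite; $P^*$ is $P$ with reversed order. A diagram on $P^*$ assigns to each $I\in P$ a finite set $D(I)$ and to each $I\leqslant J$ in $P$ a map $D(J\geqslant I)\colon D(J)\to D(I)$, functorially. The inflation $P_D$ is the poset on $\bigsqcup_{I\in P}D(I)$ where, for $d\in D(I)$ and $e\in D(J)$, $d\leqslant e$ iff $I\leqslant J$ and $D(J\geqslant I)(e)=d$. The Alexandrov space $X_{P^*}$ has underlying set $P$ and open sets the upper ideals of $P^*$ (= lower ideals of $P$). The associated sheaf $\mathcal D$ assigns to a nonempty open $U$ the set $\mathcal D(U)=\{(v_I)_{I\in U}\in\prod_{I\in U}D(I): D(J\geqslant I)(v_J)=v_I\text{ whenever } I\leqslant J \text{ in } U\}$, with restriction maps given by projection. $\mathcal D$ is inhabited if $\mathcal D(U)\neq\emptyset$ for every nonempty open $U$, and flabby if every restriction map $\mathcal D(U)\to\mathcal D(V)$, $\emptyset\neq V\subseteq U$ open, is surjective. The geometric realization $|Q|$ of a poset is the realization of its order complex (simplices = nonempty chains). A wedge of zero spheres is a point (so contractible spaces count as wedges of spheres). The number of spheres in the wedge is denoted $n(D)$. *)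

theory Defs
  imports "HOL-Analysis.Analysis"
begin

definition face_poset :: "nat \<Rightarrow> nat set set" where
  "face_poset n = {I. I \<subseteq> {1..n} \<and> I \<noteq> {}}"

definition is_diagram :: "nat set set \<Rightarrow> (nat set \<Rightarrow> 'b set) \<Rightarrow> (nat set \<Rightarrow> nat set \<Rightarrow> 'b \<Rightarrow> 'b) \<Rightarrow> bool" where
  "is_diagram P D r \<longleftrightarrow>
     (\<forall>I\<in>P. finite (D I)) \<and>
     (\<forall>I\<in>P. \<forall>J\<in>P. I \<subseteq> J \<longrightarrow> (\<forall>e\<in>D J. r J I e \<in> D I)) \<and>
     (\<forall>I\<in>P. \<forall>d\<in>D I. r I I d = d) \<and>
     (\<forall>I\<in>P. \<forall>J\<in>P. \<forall>K\<in>P. I \<subseteq> J \<longrightarrow> J \<subseteq> K \<longrightarrow> (\<forall>e\<in>D K. r J I (r K J e) = r K I e))"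

definition alex_open :: "nat set set \<Rightarrow> nat set set \<Rightarrow> bool" where
  "alex_open P U \<longleftrightarrow> U \<subseteq> P \<and> (\<forall>J\<in>U. \<forall>I\<in>P. I \<subseteq> J \<longrightarrow> I \<in> U)"

definition sections :: "(nat set \<Rightarrow> 'b set) \<Rightarrow> (nat set \<Rightarrow> nat set \<Rightarrow> 'b \<Rightarrow> 'b) \<Rightarrow> nat set set \<Rightarrow> (nat set \<Rightarrow> 'b) set" where
  "sections D r U = {v. (\<forall>I\<in>U. v I \<in> D I) \<and> (\<forall>I. I \<notin> U \<longrightarrow> v I = undefined) \<and>
       (\<forall>I\<in>U. \<forall>J\<in>U. I \<subseteq> J \<longrightarrow> r J I (v J) = v I)}"

definition sheaf_inhabited :: "nat set set \<Rightarrow> (nat set \<Rightarrow> 'b set) \<Rightarrow> (nat set \<Rightarrow> nat set \<Rightarrow> 'b \<Rightarrow> 'b) \<Rightarrow> bool" where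
  "sheaf_inhabited P D r \<longleftrightarrow> (\<forall>U. alex_open P U \<and> U \<noteq> {} \<longrightarrow> sections D r U \<noteq> {})"

definition sheaf_flabby :: "nat set set \<Rightarrow> (nat set \<Rightarrow> 'b set) \<Rightarrow> (nat set \<Rightarrow> nat set \<Rightarrow> 'b \<Rightarrow> 'b) \<Rightarrow> bool" where
  "sheaf_flabby P D r \<longleftrightarrow>
     (\<forall>U V. alex_open P U \<and> alex_open P V \<and> V \<noteq> {} \<and> V \<subseteq> U \<longrightarrow>
        (\<lambda>v. restrict v V) ` sections D r U = sections D r V)"

definition inflation_set :: "nat set set \<Rightarrow> (nat set \<Rightarrow> 'b set) \<Rightarrow> (nat set \<times> 'b) set" where
  "inflation_set P D = {(I, d). I \<in> P \<and> d \<in> D I}"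

definition inflation_le :: "(nat set \<Rightarrow> nat set \<Rightarrow> 'b \<Rightarrow> 'b) \<Rightarrow> nat set \<times> 'b \<Rightarrow> nat set \<times> 'b \<Rightarrow> bool" where
  "inflation_le r x y \<longleftrightarrow> fst x \<subseteq> fst y \<and> r (fst y) (fst x) (snd y) = snd x"

text \<open>Geometric realization of the order complex of a finite poset (V, le): the points are
  convex combinations of vertices whose support is a (nonempty) chain, topologised as a subspace
  of the finite-dimensional real vector space of functions V \<rightarrow> real.\<close>
definition order_complex_realization :: "'v set \<Rightarrow> ('v \<Rightarrow> 'v \<Rightarrow> bool) \<Rightarrow> ('v \<Rightarrow> real) topology" where
  "order_complex_realization V le = top_of_set
     {f. (\<forall>x. 0 \<le> f x) \<and> (\<forall>x. x \<notin> V \<longrightarrow> f x = 0) \<and> sum f V = 1 \<and>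
         (\<forall>x\<in>V. \<forall>y\<in>V. 0 < f x \<and> 0 < f y \<longrightarrow> le x y \<or> le y x)}"

text \<open>Wedge of k spheres of dimension m, realised concretely in R^(k(m+1)) (coordinates nat):
  the i-th sphere is the unit sphere in the coordinate block {i(m+1) ..< (i+1)(m+1)} centred at
  the basis vector e_{i(m+1)}; all spheres pass through the origin and meet only there.
  For k = 0 this is the single point 0.\<close>
definition wedge_of_spheres :: "nat \<Rightarrow> nat \<Rightarrow> (nat \<Rightarrow> real) topology" where
  "wedge_of_spheres k m = top_of_set
     (insert (\<lambda>_. 0) (\<Union>i<k. {x. (\<forall>j. j \<notin> {i*(m+1)..<(i+1)*(m+1)} \<longrightarrow> x j = 0) \<and>
         (\<Sum>j\<in>{i*(m+1)..<(i+1)*(m+1)}. (x j - (if j = i*(m+1) then 1 else 0))^2) = 1}))"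

end

theory Submission
  imports Defs
begin

text \<open>Adjoin the empty set to the index poset, with a single point as its fibre. Inhabitedness and flabbiness then
  say that every compatible family on the proper subsets of \<open>J\<close> lifts to \<open>D J\<close>. Choose one such lift for
  each family. The choices extend every \<open>e \<in> D J\<close> to a canonical global section, and for each colour
  \<open>i\<close> the elements \<open>(J, e)\<close> for which \<open>e\<close> is the canonical extension of its restriction to
  \<open>J - {i}\<close> form a cone. Adding an element to \<open>J\<close> canonically preserves all these cones, so by homotopy
  extension their union is contractible. What is missing from the union are elements over the full index set, that is,
  open top-dimensional cells; collapsing the contractible part turns each of their closures into an
  \<open>(n - 1)\<close>-sphere.\<close>

text \<open>The obstacle is coherence. If lifts were chosen independently, extending a restriction
  of \<open>e\<close> need not give the restriction of the extension of \<open>e\<close>; adding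
  \<open>i\<close> to an index need not be monotone, and the cones need not be subcomplexes. A
  choice made from boundary values alone is local: the values of the section through
  \<open>e\<close> on subsets of \<open>L\<close> depend only on the restriction of \<open>e\<close>
  to \<open>I \<inter> L\<close>. For \<open>L = {i}\<close> this gives all elements of cone
  \<open>i\<close> the same apex, because everything restricts to the single point over the empty
  set. An index that omits \<open>i\<close> satisfies the condition of colour \<open>i\<close>
  trivially, which is why only elements over the full index set can escape all cones. The cones are
  glued one at a time. The deformation of a new cone respects the union built so far, so no multiple
  intersection has to be examined. The final collapse forms no quotient space: an explicit inverse
  stereographic map onto the wedge is automatically a quotient map, because the realization is
  compact and the wedge is Hausdorff.\<close>

section \<open>Homotopy extension in order complexes\<close>

text \<open>\<open>W\<close> plays the role of \<open>X / T\<close>. The end of the homotopy is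
  constant on \<open>T\<close>, so it descends to a map \<open>g\<close> from \<open>W\<close> to
  \<open>X\<close>; the homotopy keeps \<open>T\<close> inside \<open>T\<close>, so its composite
  with \<open>q\<close> descends to a homotopy on \<open>W\<close>. These are the two homotopies
  that make \<open>q\<close> and \<open>g\<close> mutually inverse.\<close>

lemma homotopy_equivalent_space_collapse:
  fixes h :: "real \<times> 'a \<Rightarrow> 'a"
  assumes X: "compact_space X" and W: "Hausdorff_space W"
    and q: "continuous_map X W q" "q ` topspace X = topspace W"
    and fibre: "\<And>x y. x \<in> topspace X \<Longrightarrow> y \<in> topspace X \<Longrightarrow> q x = q y \<Longrightarrow> x = y \<or> x \<in> T \<and> y \<in> T"
    and qT: "\<And>x. x \<in> T \<Longrightarrow> q x = b"
    and h: "continuous_map (prod_topology (top_of_set {0..1}) X) X h"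
    and h0: "\<And>x. x \<in> topspace X \<Longrightarrow> h (0, x) = x"
    and hT: "\<And>t x. t \<in> {0..1} \<Longrightarrow> x \<in> T \<Longrightarrow> h (t, x) \<in> T"
    and h1: "\<And>x. x \<in> T \<Longrightarrow> h (1, x) = a"
  shows "X homotopy_equivalent_space W"
proof -
  let ?I = "top_of_set {0..1::real}"
  have cI: "compact_space ?I" by (simp add: compact_space_subtopology)
  have hI: "Hausdorff_space ?I" by (simp add: Hausdorff_space_subtopology)
  have quo: "quotient_map X W q"
    using T1_Spaces.continuous_imp_quotient_map[OF q(1) X W q(2)] .
  have h1c: "continuous_map X X (\<lambda>x. h (1, x))"
    using continuous_map_o_Pair[OF h, of 1] by (simp add: o_def)
  obtain g where g: "continuous_map W X g" "\<And>x. x \<in> topspace X \<Longrightarrow> g (q x) = h (1, x)"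
  proof (rule quotient_map_lift_exists[OF quo h1c])
    fix x y assume "x \<in> topspace X" "y \<in> topspace X" "q x = q y"
    then show "h (1, x) = h (1, y)" using fibre h1 by metis
  qed blast
  define qq where "qq = (\<lambda>p::real \<times> 'a. (fst p, q (snd p)))"
  have qqc: "continuous_map (prod_topology ?I X) (prod_topology ?I W) qq"
    unfolding qq_def
    by (intro continuous_map_pairedI continuous_map_fst continuous_map_compose[OF continuous_map_snd q(1), unfolded o_def])
  have qqs: "qq ` topspace (prod_topology ?I X) = topspace (prod_topology ?I W)"
    using q(2) by (force simp: qq_def image_iff)
  \<comment> \<open>A product of a quotient map with an identity need not be a quotient map; here
    compactness of the product with the interval settles it again.\<close>
  have qquo: "quotient_map (prod_topology ?I X) (prod_topology ?I W) qq"
    using T1_Spaces.continuous_imp_quotient_map[OF qqc _ _ qqs] X W cI hI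
    by (simp add: compact_space_prod_topology Hausdorff_space_prod_topology)
  have qh: "continuous_map (prod_topology ?I X) W (\<lambda>p. q (h p))"
    using continuous_map_compose[OF h q(1)] by (simp add: o_def)
  obtain k where k: "continuous_map (prod_topology ?I W) W k"
    "\<And>p. p \<in> topspace (prod_topology ?I X) \<Longrightarrow> k (qq p) = q (h p)"
  proof (rule quotient_map_lift_exists[OF qquo qh])
    fix p p' assume p: "p \<in> topspace (prod_topology ?I X)" "p' \<in> topspace (prod_topology ?I X)" "qq p = qq p'"
    obtain t x x' where [simp]: "p = (t, x)" "p' = (t, x')"
      using p(3) by (metis (no_types, lifting) Pair_inject prod.collapse qq_def)
    have "x = x' \<or> x \<in> T \<and> x' \<in> T" using p fibre by (auto simp: qq_def)
    then show "q (h p) = q (h p')" using hT[of t] qT p(1) by auto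
  qed blast
  have "homotopic_with (\<lambda>x. True) X X id (g \<circ> q)"
    unfolding homotopic_with[where P = "\<lambda>x. True", simplified]
    using h h0 g(2) by (intro exI[of _ h]) auto
  moreover have "homotopic_with (\<lambda>x. True) W W id (q \<circ> g)"
    unfolding homotopic_with[where P = "\<lambda>x. True", simplified]
  proof (intro exI[of _ k] conjI ballI)
    fix w assume "w \<in> topspace W"
    then obtain x where x: "x \<in> topspace X" "w = q x" using q(2) by blast
    show "k (0, w) = id w" using k(2)[of "(0, x)"] x h0 by (simp add: qq_def)
    show "k (1, w) = (q \<circ> g) w" using k(2)[of "(1, x)"] x g by (simp add: qq_def)
  qed (use k in auto)
  ultimately show ?thesis unfolding homotopy_equivalent_space_def
    using q(1) g(1) by (metis homotopic_with_sym)
qed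

text \<open>Points are functions on the whole vertex type that vanish outside \<open>V\<close>.
  Hence the subcomplex on a subset of vertices is literally a subset of the complex, and no
  inclusion maps are needed.\<close>

definition chain_points :: "'v set \<Rightarrow> ('v \<Rightarrow> 'v \<Rightarrow> bool) \<Rightarrow> ('v \<Rightarrow> real) set" where
  "chain_points V le = {f. (\<forall>x. 0 \<le> f x) \<and> (\<forall>x. x \<notin> V \<longrightarrow> f x = 0) \<and> sum f V = 1 \<and>
         (\<forall>x\<in>V. \<forall>y\<in>V. 0 < f x \<and> 0 < f y \<longrightarrow> le x y \<or> le y x)}"

lemma chain_points_nonneg: "f \<in> chain_points V le \<Longrightarrow> 0 \<le> f x"
  by (simp add: chain_points_def)

lemma chain_points_pos_iff: "f \<in> chain_points V le \<Longrightarrow> 0 < f x \<longleftrightarrow> f x \<noteq> 0"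
  using chain_points_nonneg[of f V le x] by linarith

lemma chain_points_support: "f \<in> chain_points V le \<Longrightarrow> f x \<noteq> 0 \<Longrightarrow> x \<in> V"
  by (auto simp: chain_points_def)

lemma chain_points_comparable:
  assumes f: "f \<in> chain_points V le" and "f x \<noteq> 0" "f y \<noteq> 0"
  shows "le x y \<or> le y x"
proof -
  have "x \<in> V" "y \<in> V" "0 < f x" "0 < f y"
    using assms chain_points_support[OF f] chain_points_pos_iff[OF f] by auto
  then show ?thesis using f unfolding chain_points_def by blast
qed

section \<open>Topology of the realization: closedness, compactness, subcomplexes\<close>

lemma continuous_on_snd_apply:
  "continuous_on S (\<lambda>p. snd p x)" for S :: "('a::topological_space \<times> ('v \<Rightarrow> 'b::topological_space)) set"
  by (rule continuous_on_product_then_coordinatewise[OF continuous_on_snd[OF continuous_on_id]])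

lemma continuous_on_apply: "continuous_on S (\<lambda>f. f x)" for S :: "('v \<Rightarrow> 'b::topological_space) set"
  by (rule continuous_on_product_then_coordinatewise[OF continuous_on_id])

lemma closed_chain_points: "closed (chain_points V le)"
proof -
  \<comment> \<open>The chain condition becomes visibly closed in this form: for an incomparable
    pair, the smaller of the two weights is at most 0.\<close>
  have "chain_points V le = (\<Inter>x. {f. 0 \<le> f x}) \<inter> (\<Inter>x\<in>-V. {f. f x = 0}) \<inter> {f. sum f V = 1} \<inter>
    (\<Inter>x\<in>V. \<Inter>y\<in>{y\<in>V. \<not> (le x y \<or> le y x)}. {f. min (f x) (f y) \<le> 0})"
    unfolding chain_points_def by (auto simp: min_le_iff_disj not_less simp flip: not_le)
  also have "closed \<dots>"
    by (intro closed_Int closed_INT ballI closed_Collect_le closed_Collect_eq continuous_on_min continuous_on_sum continuous_on_const continuous_on_apply)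
  finally show ?thesis .
qed

lemma compact_chain_points:
  assumes "finite V" shows "compact (chain_points V le)"
proof -
  \<comment> \<open>The vertex type may be infinite, so compactness is taken from Tychonoff's
    theorem for the full cube.\<close>
  have "compactin euclidean (PiE UNIV (\<lambda>x::'a. {0..1::real}))"
    unfolding euclidean_product_topology[symmetric] compactin_PiE by simp
  then have "compact (PiE UNIV (\<lambda>x::'a. {0..1::real}))" by simp
  moreover have "chain_points V le \<subseteq> PiE UNIV (\<lambda>x. {0..1})"
  proof
    fix f assume f: "f \<in> chain_points V le"
    have "f x \<le> 1" for x
      using f member_le_sum[of x V f] assms by (cases "x \<in> V") (auto simp: chain_points_def)
    with f show "f \<in> PiE UNIV (\<lambda>x. {0..1})" by (auto simp: chain_points_def)
  qed
  ultimately show ?thesis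
    using compact_Int_closed[OF _ closed_chain_points[of V le]] by (metis Int_absorb1)
qed

lemma chain_points_subset_iff:
  assumes "finite V" "A \<subseteq> V"
  shows "f \<in> chain_points A le \<longleftrightarrow> f \<in> chain_points V le \<and> (\<forall>x\<in>V - A. f x = 0)"
proof -
  have "sum f V = sum f A" if "\<forall>x\<in>V - A. f x = 0"
    using that assms by (intro sum.mono_neutral_right) auto
  moreover have "sum f V = sum f A" if "\<forall>x. x \<notin> A \<longrightarrow> f x = 0"
    using that assms by (intro sum.mono_neutral_right) auto
  ultimately show ?thesis using assms(2) unfolding chain_points_def by (auto; metis less_irrefl subsetD)
qed

lemma chain_points_vertex: "v \<in> V \<Longrightarrow> finite V \<Longrightarrow> le v v \<Longrightarrow> (\<lambda>x. if x = v then 1 else 0) \<in> chain_points V le"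
  by (auto simp: chain_points_def)

text \<open>Subtracting \<open>t * \<alpha>\<close> from the weights outside \<open>L\<close> retracts a neighbourhood
  of the subcomplex that shrinks with the time \<open>t\<close>, so nothing has to be divided by the distance to \<open>L\<close>.\<close>
lemma chain_points_homotopy_extension:
  fixes H :: "real \<times> ('v \<Rightarrow> real) \<Rightarrow> 'z::topological_space"
  assumes V: "finite V" and L: "L \<subseteq> V"
    and F: "continuous_on (chain_points V le) F" "F ` chain_points V le \<subseteq> Z"
    and H: "continuous_on ({0..1} \<times> chain_points L le) H" "H ` ({0..1} \<times> chain_points L le) \<subseteq> Z"
    and H0: "\<And>f. f \<in> chain_points L le \<Longrightarrow> H (0, f) = F f"
  obtains G where "continuous_on ({0..1} \<times> chain_points V le) G" "G ` ({0..1} \<times> chain_points V le) \<subseteq> Z"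
    "\<And>f. f \<in> chain_points V le \<Longrightarrow> G (0, f) = F f"
    "\<And>t f. t \<in> {0..1} \<Longrightarrow> f \<in> chain_points L le \<Longrightarrow> G (t, f) = H (t, f)"
proof -
  let ?K = "{0..1::real} \<times> chain_points V le"
  \<comment> \<open>Small enough that cutting every weight by at most \<open>\<alpha>\<close> leaves
    positive total mass, so that \<open>u\<close> can be normalised.\<close>
  define \<alpha> :: real where "\<alpha> = 1 / (2 * (1 + real (card V)))"
  have \<alpha>: "0 < \<alpha>" "\<alpha> * card V < 1" by (auto simp: \<alpha>_def field_simps)
  define u where "u = (\<lambda>(p::real \<times> ('v \<Rightarrow> real)) x. if x \<in> L then snd p x else if x \<in> V then max 0 (snd p x - fst p * \<alpha>) else 0)"
  define g where "g = (\<lambda>p x. u p x / sum (u p) V)"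
  define w where "w = (\<lambda>p::real \<times> ('v \<Rightarrow> real). sum (snd p) (V - L))"
  have Lcl: "closed (chain_points L le)" by (rule closed_chain_points)
  have upos: "sum (u p) V > 0" if p: "p \<in> ?K" for p
  proof -
    have "sum (snd p) V - \<alpha> * card V \<le> (\<Sum>x\<in>V. u p x)"
    proof -
      have "snd p x - \<alpha> \<le> u p x" for x
      proof -
        have "fst p * \<alpha> \<le> \<alpha>" using p \<alpha> by (intro mult_left_le_one_le) auto
        moreover have "0 \<le> snd p x" using p by (auto simp: chain_points_def)
        moreover have "snd p x = 0" if "x \<notin> V" using p that by (auto simp: chain_points_def)
        ultimately show ?thesis using \<alpha>(1) unfolding u_def by (smt (verit))
      qed
      then have "(\<Sum>x\<in>V. snd p x - \<alpha>) \<le> (\<Sum>x\<in>V. u p x)" by (intro sum_mono) auto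
      then show ?thesis by (simp add: sum_subtractf mult.commute)
    qed
    moreover have "sum (snd p) V = 1" using p by (auto simp: chain_points_def)
    ultimately show ?thesis using \<alpha> by linarith
  qed
  have unn: "0 \<le> u p x" "0 < u p x \<Longrightarrow> 0 < snd p x" if "p \<in> ?K" for p x
  proof -
    have "0 \<le> snd p x" "0 \<le> fst p * \<alpha>" using that \<alpha> by (auto simp: chain_points_def)
    then show "0 \<le> u p x" "0 < u p x \<Longrightarrow> 0 < snd p x" by (auto simp: u_def split: if_splits)
  qed
  have uV: "u p x = 0" if "x \<notin> V" for p x using that L by (auto simp: u_def)
  have gV: "g p \<in> chain_points V le" if p: "p \<in> ?K" for p
  proof -
    have "sum (g p) V = 1" using upos[OF p] by (simp add: g_def sum_divide_distrib[symmetric])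
    moreover have "0 < g p x \<Longrightarrow> 0 < snd p x" for x
      using unn[OF p] upos[OF p] by (simp add: g_def zero_less_divide_iff)
    moreover have "snd p \<in> chain_points V le" using p by auto
    ultimately show ?thesis using unn(1)[OF p] upos[OF p] uV
      unfolding chain_points_def by (auto simp: g_def)
  qed
  have wx: "snd p x \<le> w p" if "p \<in> ?K" "x \<in> V - L" for p x
    unfolding w_def using that V by (intro member_le_sum) (auto simp: chain_points_def)
  have gL: "g p \<in> chain_points L le" if p: "p \<in> ?K" "w p \<le> fst p * \<alpha>" for p
    unfolding chain_points_subset_iff[OF V L]
    using gV[OF p(1)] wx[OF p(1)] p(2) by (fastforce simp: g_def u_def)
  have wL: "w p = 0" "g p = snd p" if "p \<in> {0..1} \<times> chain_points L le" for p
  proof -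
    from that have z: "snd p x = 0" if "x \<notin> L" for x using that by (auto simp: chain_points_def)
    then show "w p = 0" by (simp add: w_def)
    have "fst p * \<alpha> \<ge> 0" using that \<alpha> by auto
    then have "u p = snd p" using z by (auto simp: u_def fun_eq_iff)
    moreover have "sum (snd p) V = 1" using that chain_points_subset_iff[OF V L] by (auto simp: chain_points_def)
    ultimately show "g p = snd p" by (simp add: g_def)
  qed
  have KL: "{0..1} \<times> chain_points L le \<subseteq> ?K" using chain_points_subset_iff[OF V L] by auto
  have wc: "continuous_on S w" for S unfolding w_def by (intro continuous_intros continuous_on_snd_apply)
  have uc: "continuous_on S (\<lambda>p. u p x)" for S x
    by (cases "x \<in> L"; cases "x \<in> V") (auto simp: u_def intro!: continuous_intros continuous_on_snd_apply)
  have gc: "continuous_on S g" if "S \<subseteq> ?K" for S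
    unfolding g_def
    using upos that by (intro continuous_on_coordinatewise_then_product continuous_intros uc) (auto simp: less_le)
  define A where "A = {p\<in>?K. w p \<le> fst p * \<alpha>}"
  define B where "B = {p\<in>?K. fst p * \<alpha> \<le> w p}"
  \<comment> \<open>On \<open>A\<close> the weight \<open>w\<close> off \<open>L\<close> is at most
    \<open>t * \<alpha>\<close>, so every single weight off \<open>L\<close> is cut to 0 and
    \<open>g\<close> lands in \<open>L\<close>. The clock \<open>t - w / \<alpha>\<close> reads 0 on
    the seam with \<open>B\<close>, where \<open>H\<close> agrees with \<open>F\<close>, and reads
    \<open>t\<close> on \<open>L\<close> itself.\<close>
  define G where "G = (\<lambda>p. if p \<in> A then H (fst p - w p / \<alpha>, g p) else F (g p))"
  have wnn: "0 \<le> w p" if "p \<in> ?K" for p using that by (auto simp: w_def chain_points_def intro!: sum_nonneg)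
  have HA: "(fst p - w p / \<alpha>, g p) \<in> {0..1} \<times> chain_points L le" if "p \<in> A" for p
  proof -
    have "0 \<le> w p / \<alpha>" "w p / \<alpha> \<le> fst p" using that wnn[of p] \<alpha> by (auto simp: A_def field_simps)
    then show ?thesis using that gL[of p] by (auto simp: A_def)
  qed
  have AB: "?K = A \<union> B" by (auto simp: A_def B_def)
  have closedin: "closedin (top_of_set (A \<union> B)) A" "closedin (top_of_set (A \<union> B)) B"
  proof -
    have "A = ?K \<inter> {p. w p \<le> fst p * \<alpha>}" "B = ?K \<inter> {p. fst p * \<alpha> \<le> w p}" by (auto simp: A_def B_def)
    then show "closedin (top_of_set (A \<union> B)) A" "closedin (top_of_set (A \<union> B)) B"
      unfolding AB[symmetric]
      by (auto intro!: closedin_closed_Int closed_Collect_le continuous_intros wc)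
  qed
  have "continuous_on (A \<union> B) G" unfolding G_def
  proof (rule continuous_on_cases_local[OF closedin, simplified])
    show "continuous_on A (\<lambda>p. H (fst p - w p / \<alpha>, g p))"
      by (rule continuous_on_compose2[OF H(1)])
        (use HA \<alpha> in \<open>auto intro!: continuous_intros wc gc simp: A_def\<close>)
    show "continuous_on B (\<lambda>p. F (g p))"
      by (rule continuous_on_compose2[OF F(1)]) (use gV in \<open>auto intro!: gc simp: B_def\<close>)
    fix p assume p: "p \<in> A \<and> p \<notin> A \<or> p \<in> B \<and> p \<in> A"
    then have "w p = fst p * \<alpha>" by (auto simp: A_def B_def)
    then have "fst p - w p / \<alpha> = 0" using \<alpha> by simp
    then show "H (fst p - w p / \<alpha>, g p) = F (g p)" using H0 HA[of p] p by simp
  qed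
  show ?thesis
  proof (rule that)
    show "continuous_on ?K G" unfolding AB by fact
    show "G ` ?K \<subseteq> Z" using HA H(2) gV F(2) unfolding G_def by (auto; blast)
    fix f assume f: "f \<in> chain_points V le"
    have "u (0, f) = f" using f by (auto simp: u_def chain_points_def fun_eq_iff)
    moreover have "sum f V = 1" using f by (auto simp: chain_points_def)
    ultimately have gf: "g (0, f) = f" by (simp add: g_def)
    show "G (0, f) = F f"
    proof (cases "(0, f) \<in> A")
      case True
      then have "w (0, f) = 0" using wnn[of "(0,f)"] by (auto simp: A_def)
      then show ?thesis using True HA[OF True] H0 gf by (simp add: G_def)
    qed (simp add: G_def gf)
  next
    fix t :: real and f assume "t \<in> {0..1}" "f \<in> chain_points L le"
    then have p: "(t, f) \<in> {0..1} \<times> chain_points L le" by simp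
    then have "(t, f) \<in> A" using subsetD[OF KL p] wL[OF p] \<alpha> by (auto simp: A_def)
    then show "G (t, f) = H (t, f)" using wL[OF p] by (simp add: G_def)
  qed
qed

section \<open>Conical deformations of finite posets and their gluing\<close>

locale finite_order =
  fixes V :: "'v set" and le :: "'v \<Rightarrow> 'v \<Rightarrow> bool"
  assumes finite_V: "finite V"
    and le_refl: "x \<in> V \<Longrightarrow> le x x"
    and le_trans: "\<lbrakk>x \<in> V; y \<in> V; z \<in> V; le x y; le y z\<rbrakk> \<Longrightarrow> le x z"
    and le_antisym: "\<lbrakk>x \<in> V; y \<in> V; le x y; le y x\<rbrakk> \<Longrightarrow> x = y"
begin

text \<open>The point \<open>v\<close> is reached through \<open>x \<le> \<phi> x \<ge> v\<close>. Straight lines from \<open>x\<close> to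
  \<open>\<phi> x\<close> would leave the order complex, so the weight of a chain is moved from the top element downwards:
  \<open>mov\<close> is the part moved by time \<open>t\<close>.\<close>
lemma chain_points_cone:
  assumes maps: "\<And>x. x \<in> V \<Longrightarrow> \<phi> x \<in> V"
    and mono: "\<And>x y. x \<in> V \<Longrightarrow> y \<in> V \<Longrightarrow> le x y \<Longrightarrow> le (\<phi> x) (\<phi> y)"
    and up: "\<And>x. x \<in> V \<Longrightarrow> le x (\<phi> x)"
    and v: "v \<in> V" "\<And>x. x \<in> V \<Longrightarrow> le v (\<phi> x)"
  obtains G where "continuous_on ({0..1::real} \<times> chain_points V le) G"
    "\<And>f. f \<in> chain_points V le \<Longrightarrow> G (0, f) = f"
    "\<And>f. f \<in> chain_points V le \<Longrightarrow> G (1, f) = (\<lambda>x. if x = v then 1 else 0)"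
    "\<And>A. A \<subseteq> V \<Longrightarrow> \<phi> ` A \<subseteq> A \<Longrightarrow> v \<in> A \<Longrightarrow> G ` ({0..1} \<times> chain_points A le) \<subseteq> chain_points A le"
proof -
  \<comment> \<open>Stack the weights of the chain with its top element first. The sum is the mass
    strictly above \<open>x\<close>, and \<open>mov\<close> is the share of \<open>f x\<close> lying
    in the first \<open>t\<close> units of the stack.\<close>
  define mov where "mov = (\<lambda>t f x. min (f x) (max 0 (t - (\<Sum>y\<in>{y\<in>V. le x y \<and> x \<noteq> y}. f y))) :: real)"
  define N where "N = (\<lambda>t f x. f x - mov t f x + (\<Sum>z\<in>{z\<in>V. \<phi> z = x}. mov t f z))"
  \<comment> \<open>The first half of the time pushes all mass along \<open>\<phi>\<close>. In the
    second half a straight line to the vertex \<open>v\<close> is legitimate, since \<open>v\<close>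
    lies below every \<open>\<phi> x\<close>.\<close>
  define G where "G = (\<lambda>p::real \<times> ('v \<Rightarrow> real). \<lambda>x.
    (1 - max 0 (2 * fst p - 1)) * N (min 1 (2 * fst p)) (snd p) x + max 0 (2 * fst p - 1) * (if x = v then 1 else 0))"
  have mov_bounds: "0 \<le> mov t f x" "mov t f x \<le> f x" if "f \<in> chain_points V le" for t f x
    using that by (auto simp: mov_def chain_points_def)
  have mov_0: "mov 0 f x = 0" if "f \<in> chain_points V le" for f x
  proof -
    have "0 \<le> (\<Sum>y\<in>{y\<in>V. le x y \<and> x \<noteq> y}. f y)" using that by (auto simp: chain_points_def intro!: sum_nonneg)
    then show ?thesis using mov_bounds[OF that, of 0 x] by (auto simp: mov_def)
  qed
  have mov_1: "mov 1 f x = f x" if f: "f \<in> chain_points V le" for f x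
  proof (cases "x \<in> V")
    case True
    have "f x + (\<Sum>y\<in>{y\<in>V. le x y \<and> x \<noteq> y}. f y) = (\<Sum>y\<in>insert x {y\<in>V. le x y \<and> x \<noteq> y}. f y)"
      using finite_V by (subst sum.insert) auto
    also have "\<dots> \<le> sum f V" using f True finite_V by (intro sum_mono2) (auto simp: chain_points_def)
    finally show ?thesis using f by (auto simp: mov_def chain_points_def)
  next
    case False
    then show ?thesis using mov_bounds[OF f, of 1 x] f by (auto simp: chain_points_def)
  qed
  have N_nn: "0 \<le> N t f x" if "f \<in> chain_points V le" for t f x
    using mov_bounds[OF that] unfolding N_def by (intro add_nonneg_nonneg sum_nonneg) auto
  have N_sum: "sum (N t f) V = 1" if f: "f \<in> chain_points V le" for t f
  proof -
    have "(\<Sum>x\<in>V. \<Sum>z\<in>{z\<in>V. \<phi> z = x}. mov t f z) = (\<Sum>z\<in>V. mov t f z)"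
      using finite_V maps by (intro sum.group) auto
    then show ?thesis using f by (simp add: N_def sum.distrib sum_subtractf chain_points_def)
  qed
  have N_pos: "mov t f x < f x \<or> (\<exists>z\<in>V. \<phi> z = x \<and> 0 < mov t f z)"
    if "f \<in> chain_points V le" "0 < N t f x" for t f x
  proof (rule ccontr)
    assume "\<not> ?thesis"
    then have "f x - mov t f x = 0" "\<forall>z\<in>{z\<in>V. \<phi> z = x}. mov t f z = 0"
      using mov_bounds[OF that(1)] by (auto simp: less_le)
    then show False using that(2) by (simp add: N_def)
  qed
  have suppV: "x \<in> V" if "f \<in> chain_points V le" "0 < f x" for f x
    using that by (auto simp: chain_points_def; metis less_irrefl)
  have comparable: "le x y \<or> le y x" if "f \<in> chain_points V le" "0 < f x" "0 < f y" for f x y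
    using that suppV[OF that(1)] by (auto simp: chain_points_def)
  \<comment> \<open>Otherwise \<open>z\<close> is strictly below \<open>x\<close> and starts to move
    only after all of \<open>f x\<close> has left. So the remaining mass lies below the moving mass,
    and thus below its image under \<open>\<phi>\<close>: supports stay chains.\<close>
  have stay_below_moved: "le x z" if f: "f \<in> chain_points V le" and x: "mov t f x < f x" and z: "0 < mov t f z" for t f x z
  proof (rule ccontr)
    assume n: "\<not> le x z"
    have fx: "0 < f x" "0 < f z" using mov_bounds[OF f] x z by (meson le_less_trans less_le_trans)+
    have xz: "x \<in> V" "z \<in> V" using suppV[OF f] fx by auto
    then have l: "le z x" "z \<noteq> x" using comparable[OF f fx] n le_refl by auto
    have "f x + (\<Sum>y\<in>{y\<in>V. le x y \<and> x \<noteq> y}. f y) = (\<Sum>y\<in>insert x {y\<in>V. le x y \<and> x \<noteq> y}. f y)"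
      using finite_V by (subst sum.insert) auto
    also have "\<dots> \<le> (\<Sum>y\<in>{y\<in>V. le z y \<and> z \<noteq> y}. f y)"
    proof (rule sum_mono2)
      show "insert x {y\<in>V. le x y \<and> x \<noteq> y} \<subseteq> {y\<in>V. le z y \<and> z \<noteq> y}"
        using xz l le_trans le_antisym by blast
    qed (use finite_V f in \<open>auto simp: chain_points_def\<close>)
    also have "\<dots> < t" using z by (auto simp: mov_def)
    finally show False using x by (auto simp: mov_def)
  qed
  have G_in: "G (s, f) \<in> chain_points V le" if s: "s \<in> {0..1}" and f: "f \<in> chain_points V le" for s f
  proof -
    let ?t = "min 1 (2 * s)" and ?u = "max 0 (2 * s - 1)"
    have u: "0 \<le> ?u" "?u \<le> 1" using s by auto
    have nn: "0 \<le> G (s, f) x" for x using u N_nn[OF f, of ?t x] by (simp add: G_def)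
    have out: "G (s, f) x = 0" if "x \<notin> V" for x
    proof -
      have "f x = 0" using f that by (auto simp: chain_points_def)
      moreover have "mov ?t f x = 0" using mov_bounds[OF f, of ?t x] \<open>f x = 0\<close> by simp
      moreover have "(\<Sum>z\<in>{z \<in> V. \<phi> z = x}. mov ?t f z) = 0"
        by (rule sum.neutral) (use maps that in auto)
      ultimately show ?thesis using v that by (auto simp: G_def N_def)
    qed
    have "(\<Sum>x\<in>V. if x = v then 1 else 0 :: real) = 1" using v finite_V by simp
    then have total: "sum (G (s, f)) V = 1"
      using N_sum[OF f, of ?t] by (simp add: G_def sum.distrib sum_distrib_left[symmetric])
    have chain: "le x y \<or> le y x" if p: "0 < G (s, f) x" "0 < G (s, f) y" for x y
    proof (cases "?u = 0")
      case True
      then have "0 < N ?t f x" "0 < N ?t f y" using p by (simp_all add: G_def)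
      from this[THEN N_pos[OF f]]
      consider "mov ?t f x < f x" "mov ?t f y < f y"
        | z where "mov ?t f x < f x" "z \<in> V" "\<phi> z = y" "0 < mov ?t f z"
        | z where "mov ?t f y < f y" "z \<in> V" "\<phi> z = x" "0 < mov ?t f z"
        | z z' where "z \<in> V" "\<phi> z = x" "0 < mov ?t f z" "z' \<in> V" "\<phi> z' = y" "0 < mov ?t f z'" by blast
      then show ?thesis
      proof cases
        case 1
        then show ?thesis using comparable[OF f] mov_bounds[OF f] by (meson le_less_trans)
      next
        case 2
        then have "le x z" "x \<in> V" using stay_below_moved[OF f] mov_bounds[OF f] suppV[OF f] by (blast, meson le_less_trans)
        then show ?thesis using 2 up le_trans maps by blast
      next
        case 3
        then have "le y z" "y \<in> V" using stay_below_moved[OF f] mov_bounds[OF f] suppV[OF f] by (blast, meson le_less_trans)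
        then show ?thesis using 3 up le_trans maps by blast
      next
        case 4
        then have "le z z' \<or> le z' z" using comparable[OF f] mov_bounds[OF f] by (meson less_le_trans)
        then show ?thesis using 4 mono by blast
      qed
    next
      case False
      then have t: "?t = 1" by auto
      have "x = v \<or> (\<exists>z\<in>V. \<phi> z = x \<and> 0 < f z)" if "0 < G (s, f) x" for x
      proof (cases "x = v")
        case False
        then have "0 < (1 - ?u) * N 1 f x" using that t by (simp add: G_def)
        then have "0 < N 1 f x" using u by (simp add: zero_less_mult_iff)
        from N_pos[OF f this] show ?thesis by (simp add: mov_1[OF f])
      qed simp
      then show ?thesis using p v le_refl mono comparable[OF f] by metis
    qed
    show ?thesis unfolding chain_points_def using nn out total chain by auto
  qed
  show ?thesis
  proof (rule that[of G])
    have "continuous_on S (\<lambda>p. mov (min 1 (2 * fst p)) (snd p) x)" for S x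
      unfolding mov_def by (intro continuous_intros continuous_on_snd_apply)
    then show "continuous_on ({0..1} \<times> chain_points V le) G"
      unfolding G_def N_def
      by (intro continuous_on_coordinatewise_then_product continuous_intros continuous_on_snd_apply)
    show "G (0, f) = f" if "f \<in> chain_points V le" for f
      using mov_0[OF that] by (simp add: G_def N_def)
    show "G (1, f) = (\<lambda>x. if x = v then 1 else 0)" if "f \<in> chain_points V le" for f
      by (simp add: G_def)
    fix A assume A: "A \<subseteq> V" "\<phi> ` A \<subseteq> A" "v \<in> A"
    have "G (s, f) \<in> chain_points A le" if s: "s \<in> {0..1}" and fA: "f \<in> chain_points A le" for s f
    proof -
      have f: "f \<in> chain_points V le" using fA chain_points_subset_iff[OF finite_V A(1)] by auto
      have "G (s, f) x = 0" if x: "x \<in> V - A" for x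
      proof -
        have z: "f y = 0" if "y \<notin> A" for y using fA that by (auto simp: chain_points_def)
        have m: "mov t f y = 0" if "y \<notin> A" for y t using mov_bounds[OF f, of t y] z[OF that] by simp
        have "y \<notin> A" if "\<phi> y = x" for y using x A that by auto
        then have "N t f x = 0" for t using m z x by (simp add: N_def)
        then show ?thesis using x A by (auto simp: G_def)
      qed
      then show ?thesis using G_in[OF s f] chain_points_subset_iff[OF finite_V A(1)] by auto
    qed
    then show "G ` ({0..1} \<times> chain_points A le) \<subseteq> chain_points A le" by auto
  qed
qed

lemma finite_order_subset:
  assumes "A \<subseteq> V" shows "finite_order A le"
proof
  show "finite A" using assms finite_V finite_subset by blast
  show "le x x" if "x \<in> A" for x using that assms le_refl by auto
  show "le x z" if "x \<in> A" "y \<in> A" "z \<in> A" "le x y" "le y z" for x y z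
    using le_trans[of x y z] that assms by auto
  show "x = y" if "x \<in> A" "y \<in> A" "le x y" "le y x" for x y
    using le_antisym[of x y] that assms by auto
qed

text \<open>A chain could have elements on both sides without lying in either set. For lower sets
  this is impossible: given one element outside \<open>A\<close> and one outside \<open>B\<close>,
  comparability pulls the smaller into the set that it is supposed to miss.\<close>

lemma chain_points_Un:
  assumes "A \<subseteq> V" "B \<subseteq> V"
    and "\<And>x y. x \<in> A \<Longrightarrow> y \<in> V \<Longrightarrow> le y x \<Longrightarrow> y \<in> A" "\<And>x y. x \<in> B \<Longrightarrow> y \<in> V \<Longrightarrow> le y x \<Longrightarrow> y \<in> B"
  shows "chain_points (A \<union> B) le = chain_points A le \<union> chain_points B le"
proof -
  have fin: "finite (A \<union> B)" using assms finite_V finite_subset by blast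
  note iff = chain_points_subset_iff[OF fin, of _ _ le]
  have "f \<in> chain_points A le \<or> f \<in> chain_points B le" if f: "f \<in> chain_points (A \<union> B) le" for f
  proof (rule ccontr)
    assume "\<not> ?thesis"
    then obtain x y where xy: "x \<in> (A \<union> B) - A" "y \<in> (A \<union> B) - B" "f x \<noteq> 0" "f y \<noteq> 0"
      using f iff[of A f] iff[of B f] by auto
    then have "0 < f x" "0 < f y" using f by (auto simp: chain_points_def less_le)
    then have "le x y \<or> le y x" using f xy by (auto simp: chain_points_def)
    then show False using assms(3)[of y x] assms(4)[of x y] assms(1,2) xy by auto
  qed
  moreover have "chain_points A le \<subseteq> chain_points (A \<union> B) le" "chain_points B le \<subseteq> chain_points (A \<union> B) le"
    using iff by blast+
  ultimately show ?thesis by blast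
qed

text \<open>The map \<open>\<phi>\<close> contracts \<open>B\<close> to \<open>v\<close> while
  carrying the part over \<open>A \<inter> B\<close> into itself. Extending this motion over
  \<open>A\<close> makes the identity of the union homotopic to a map into the contractible piece
  \<open>A\<close>. Nothing beyond this invariance is asked of \<open>A \<inter> B\<close>.\<close>

lemma contractible_chain_points_Un_cone:
  assumes A: "A \<subseteq> V" "\<And>x y. x \<in> A \<Longrightarrow> y \<in> V \<Longrightarrow> le y x \<Longrightarrow> y \<in> A" "contractible (chain_points A le)"
    and B: "B \<subseteq> V" "\<And>x y. x \<in> B \<Longrightarrow> y \<in> V \<Longrightarrow> le y x \<Longrightarrow> y \<in> B"
    and \<phi>: "\<And>x. x \<in> B \<Longrightarrow> \<phi> x \<in> B" "\<And>x. x \<in> A \<Longrightarrow> x \<in> B \<Longrightarrow> \<phi> x \<in> A"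
      "\<And>x y. x \<in> B \<Longrightarrow> y \<in> B \<Longrightarrow> le x y \<Longrightarrow> le (\<phi> x) (\<phi> y)"
      "\<And>x. x \<in> B \<Longrightarrow> le x (\<phi> x)"
    and v: "v \<in> A" "v \<in> B" "\<And>x. x \<in> B \<Longrightarrow> le v (\<phi> x)"
  shows "contractible (chain_points (A \<union> B) le)"
proof -
  interpret B: finite_order B le using finite_order_subset[OF B(1)] .
  have finA: "finite A" using A(1) finite_V finite_subset by blast
  let ?K = "\<lambda>A. chain_points A le" and ?d = "\<lambda>x. if x = v then 1 else 0::real"
  obtain G where G: "continuous_on ({0..1::real} \<times> ?K B) G"
    "\<And>f. f \<in> ?K B \<Longrightarrow> G (0, f) = f" "\<And>f. f \<in> ?K B \<Longrightarrow> G (1, f) = ?d"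
    "\<And>A. A \<subseteq> B \<Longrightarrow> \<phi> ` A \<subseteq> A \<Longrightarrow> v \<in> A \<Longrightarrow> G ` ({0..1} \<times> ?K A) \<subseteq> ?K A"
    by (rule B.chain_points_cone[of \<phi> v]) (use \<phi>(1,3,4) v(2,3) in auto)
  have zero: "f x = 0" if "f \<in> ?K C" "x \<notin> C" for f x C using that by (auto simp: chain_points_def)
  have Int: "?K (A \<inter> B) = ?K A \<inter> ?K B"
  proof (rule set_eqI)
    fix f
    have "f \<in> ?K (A \<inter> B) \<longleftrightarrow> f \<in> ?K A \<and> (\<forall>x\<in>A - A \<inter> B. f x = 0)"
      "f \<in> ?K (A \<inter> B) \<longleftrightarrow> f \<in> ?K B \<and> (\<forall>x\<in>B - A \<inter> B. f x = 0)"
      by (rule chain_points_subset_iff; use finA B.finite_V in auto)+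
    then show "f \<in> ?K (A \<inter> B) \<longleftrightarrow> f \<in> ?K A \<inter> ?K B" using zero[of f B] by auto
  qed
  have GInt: "G ` ({0..1} \<times> ?K (A \<inter> B)) \<subseteq> ?K (A \<inter> B)" using v \<phi> by (intro G(4)) auto
  have GB: "G ` ({0..1} \<times> ?K B) \<subseteq> ?K B" using v \<phi> by (intro G(4)) auto
  obtain G' where G': "continuous_on ({0..1} \<times> ?K A) G'" "G' ` ({0..1} \<times> ?K A) \<subseteq> ?K A"
    "\<And>f. f \<in> ?K A \<Longrightarrow> G' (0, f) = f" "\<And>t f. t \<in> {0..1} \<Longrightarrow> f \<in> ?K (A \<inter> B) \<Longrightarrow> G' (t, f) = G (t, f)"
  proof (rule chain_points_homotopy_extension[OF finA, of "A \<inter> B" le id "?K A" G])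
    show "continuous_on ({0..1} \<times> ?K (A \<inter> B)) G"
      by (rule continuous_on_subset[OF G(1)]) (use Int in auto)
  qed (use GInt Int G(2) in auto)
  have Un: "?K (A \<union> B) = ?K A \<union> ?K B" using A B by (intro chain_points_Un) auto
  define Gh where "Gh = (\<lambda>p. if p \<in> {0..1} \<times> ?K B then G p else G' p)"
  have cl: "closed ({0..1::real} \<times> ?K C)" for C by (intro closed_Times closed_chain_points) auto
  have Ghc: "continuous_on ({0..1} \<times> ?K B \<union> {0..1} \<times> ?K A) Gh"
    unfolding Gh_def
    by (intro continuous_on_cases cl G(1) G'(1)) (use G'(4) Int in auto)
  have eq: "{0..1} \<times> ?K (A \<union> B) = {0..1} \<times> ?K B \<union> {0..1::real} \<times> ?K A" using Un by auto
  have GhB: "Gh (t, f) = G (t, f)" "G (t, f) \<in> ?K B" if "t \<in> {0..1}" "f \<in> ?K B" for t f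
    using that GB by (auto simp: Gh_def)
  have GhA: "Gh (t, f) = G' (t, f)" "G' (t, f) \<in> ?K A" if "t \<in> {0..1}" "f \<in> ?K A" for t f
    using that G'(2) G'(4)[OF that(1), of f] Int by (auto simp: Gh_def)
  have GhK: "Gh ` ({0..1} \<times> ?K (A \<union> B)) \<subseteq> ?K (A \<union> B)"
  proof (clarify, unfold Un)
    fix t :: real and f assume t: "t \<in> {0..1}" and "f \<in> ?K A \<union> ?K B"
    then show "Gh (t, f) \<in> ?K A \<union> ?K B" using GhA[OF t] GhB[OF t] by (metis UnCI UnE)
  qed
  have h: "homotopic_with_canon (\<lambda>x. True) (?K (A \<union> B)) (?K (A \<union> B)) id (\<lambda>f. Gh (1, f))"
    unfolding homotopic_with[where P = "\<lambda>x. True", simplified]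
  proof (intro exI[of _ Gh] conjI ballI)
    show "continuous_map (prod_topology (top_of_set {0..1}) (top_of_set (?K (A \<union> B)))) (top_of_set (?K (A \<union> B))) Gh"
      using Ghc GhK unfolding eq[symmetric] by (simp add: subtopology_Times[symmetric] image_subset_iff_funcset)
    fix f assume "f \<in> topspace (top_of_set (?K (A \<union> B)))"
    then show "Gh (0, f) = id f" using GhA(1)[of 0 f] GhB(1)[of 0 f] G(2) G'(3) Un by auto
  qed auto
  have dA: "?d \<in> ?K A" using v finA A le_refl by (intro chain_points_vertex) auto
  \<comment> \<open>At time 1 the cone \<open>B\<close> has shrunk to the vertex \<open>v\<close>,
    which belongs to \<open>A\<close>; the points of \<open>A\<close> never left it.\<close>
  have im: "(\<lambda>f. Gh (1, f)) \<in> ?K (A \<union> B) \<rightarrow> ?K A"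
  proof
    fix f assume "f \<in> ?K (A \<union> B)"
    then show "Gh (1, f) \<in> ?K A" using GhA[of 1 f] GhB(1)[of 1 f] G(3)[of f] dA Un by auto
  qed
  have c1: "continuous_on (?K (A \<union> B)) (\<lambda>f. Gh (1, f))"
    by (rule continuous_on_compose2[OF Ghc[folded eq]]) (auto intro!: continuous_intros)
  have idm: "id \<in> ?K A \<rightarrow> ?K (A \<union> B)" using Un by auto
  obtain c where "homotopic_with_canon (\<lambda>x. True) (?K (A \<union> B)) (?K (A \<union> B)) (id \<circ> (\<lambda>f. Gh (1, f))) (\<lambda>x. c)"
    by (rule nullhomotopic_through_contractible[OF c1 im _ _ A(3), of id]) (use idm in \<open>auto simp: id_def\<close>)
  from homotopic_with_trans[OF h this[unfolded id_comp]] show ?thesis unfolding contractible_def by blast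
qed

end

section \<open>Canonical extensions in flabby diagrams\<close>

text \<open>A flabby diagram in which the empty set is added as an index whose fibre is a single point, so that
  flabbiness and inhabitedness become one extension property.\<close>
locale full_diagram =
  fixes N :: "nat set" and D :: "nat set \<Rightarrow> 'b set" and r :: "nat set \<Rightarrow> nat set \<Rightarrow> 'b \<Rightarrow> 'b" and pt :: 'b
  assumes finite_N: "finite N"
    and finite_D: "I \<subseteq> N \<Longrightarrow> finite (D I)"
    and D_empty: "D {} = {pt}"
    and restr_in: "\<lbrakk>I \<subseteq> J; J \<subseteq> N; e \<in> D J\<rbrakk> \<Longrightarrow> r J I e \<in> D I"
    and restr_id: "\<lbrakk>I \<subseteq> N; e \<in> D I\<rbrakk> \<Longrightarrow> r I I e = e"
    and restr_restr: "\<lbrakk>I \<subseteq> J; J \<subseteq> K; K \<subseteq> N; e \<in> D K\<rbrakk> \<Longrightarrow> r J I (r K J e) = r K I e"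
    and extend: "\<lbrakk>J \<subseteq> N; J \<noteq> {}; \<And>I. I \<subset> J \<Longrightarrow> v I \<in> D I;
        \<And>I K. I \<subseteq> K \<Longrightarrow> K \<subset> J \<Longrightarrow> r K I (v K) = v I\<rbrakk> \<Longrightarrow> \<exists>e\<in>D J. \<forall>I. I \<subset> J \<longrightarrow> r J I e = v I"
begin

definition lift :: "nat set \<Rightarrow> (nat set \<Rightarrow> 'b) \<Rightarrow> 'b" where
  "lift J v = (SOME e. e \<in> D J \<and> (\<forall>I. I \<subset> J \<longrightarrow> r J I e = v I))"

lemma lift_cong: "(\<And>I. I \<subset> J \<Longrightarrow> v I = w I) \<Longrightarrow> lift J v = lift J w"
  unfolding lift_def by (metis (no_types, lifting))

text \<open>The value at \<open>K\<close> of a canonical global section through \<open>e \<in> D I\<close>. Since the choice made by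
  \<open>lift\<close> depends only on the boundary values, these sections for different \<open>I\<close> are compatible
  in the sense of \<open>canon_Int\<close> and \<open>canon_canon\<close> below.\<close>
function canon :: "nat set \<Rightarrow> 'b \<Rightarrow> nat set \<Rightarrow> 'b" where
  "canon I e K = (if K \<subseteq> I then r I K e
     else if finite K then lift K (\<lambda>L. if L \<subset> K then canon I e L else undefined) else undefined)"
  by auto
text \<open>The guards \<open>finite K\<close> and \<open>L \<subset> K\<close> in the equation are
  what makes the cardinality of the last argument drop.\<close>

termination by (relation "Wellfounded.measure (\<lambda>(I, e, K). card K)") (auto intro: psubset_card_mono)

declare canon.simps [simp del]

lemma canon_below: "K \<subseteq> I \<Longrightarrow> canon I e K = r I K e"
  by (subst canon.simps) simp

lemma canon_lift: "\<not> K \<subseteq> I \<Longrightarrow> K \<subseteq> N \<Longrightarrow> canon I e K = lift K (canon I e)"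
  using finite_subset[OF _ finite_N, of K] by (subst canon.simps) (simp, rule lift_cong, simp)

lemma subset_N_induct [consumes 1, case_names psubset]:
  assumes "K \<subseteq> N" "\<And>K. K \<subseteq> N \<Longrightarrow> (\<And>L. L \<subset> K \<Longrightarrow> P L) \<Longrightarrow> P K"
  shows "P K"
proof -
  have "finite K" using assms(1) finite_N finite_subset by blast
  then show ?thesis using assms(1)
  proof (induction rule: finite_psubset_induct)
    case (psubset A)
    show ?case
    proof (rule assms(2)[OF psubset.prems])
      fix L assume "L \<subset> A"
      then show "P L" using psubset.IH psubset.prems by auto
    qed
  qed
qed

text \<open>Membership and compatibility go through one induction: together, at the proper subsets
  of \<open>K\<close>, they are the hypotheses of \<open>extend\<close>, which guarantees that the
  choice at \<open>K\<close> is made from a nonempty set.\<close>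

lemma canon_in_restr:
  assumes I: "I \<subseteq> N" "e \<in> D I" and "K \<subseteq> N"
  shows "canon I e K \<in> D K \<and> (\<forall>L. L \<subseteq> K \<longrightarrow> r K L (canon I e K) = canon I e L)"
  using \<open>K \<subseteq> N\<close>
proof (induction K rule: subset_N_induct)
  case (psubset K)
  show ?case
  proof (cases "K \<subseteq> I")
    case True
    then show ?thesis using I by (auto simp: canon_below restr_in restr_restr)
  next
    case False
    have "\<exists>d\<in>D K. \<forall>L. L \<subset> K \<longrightarrow> r K L d = canon I e L"
      using psubset False by (intro extend) auto
    then have ex: "\<exists>d. d \<in> D K \<and> (\<forall>L. L \<subset> K \<longrightarrow> r K L d = canon I e L)" by blast
    then have *: "canon I e K \<in> D K \<and> (\<forall>L. L \<subset> K \<longrightarrow> r K L (canon I e K) = canon I e L)"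
      unfolding canon_lift[OF False psubset.hyps] lift_def by (rule someI_ex)
    moreover have "r K K (canon I e K) = canon I e K" using * psubset.hyps restr_id by blast
    ultimately show ?thesis using psubsetI by metis
  qed
qed

lemma canon_in: "I \<subseteq> N \<Longrightarrow> e \<in> D I \<Longrightarrow> K \<subseteq> N \<Longrightarrow> canon I e K \<in> D K"
  and canon_restr: "I \<subseteq> N \<Longrightarrow> e \<in> D I \<Longrightarrow> K \<subseteq> N \<Longrightarrow> L \<subseteq> K \<Longrightarrow> r K L (canon I e K) = canon I e L"
  using canon_in_restr by blast+

text \<open>The section passes through the element that it starts from.\<close>

lemma canon_self: "I \<subseteq> N \<Longrightarrow> e \<in> D I \<Longrightarrow> canon I e I = e"
  by (simp add: canon_below restr_id)

text \<open>Locality: inside \<open>L\<close> the recursion consults \<open>e\<close> only on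
  subsets of \<open>I \<inter> L\<close>; elsewhere both sides choose a lift of the same boundary
  values.\<close>

lemma canon_Int:
  assumes I: "I \<subseteq> N" "e \<in> D I" and "M \<subseteq> L" "L \<subseteq> N"
  shows "canon I e M = canon (I \<inter> L) (r I (I \<inter> L) e) M"
proof -
  have "M \<subseteq> N" using assms by auto
  then show ?thesis using \<open>M \<subseteq> L\<close>
  proof (induction M rule: subset_N_induct)
    case (psubset M)
    show ?case
    proof (cases "M \<subseteq> I")
      case True
      then show ?thesis using I psubset.prems by (simp add: canon_below restr_restr)
    next
      case False
      then show ?thesis using psubset by (auto simp: canon_lift intro!: lift_cong)
    qed
  qed
qed

text \<open>Extension in two stages agrees with extension in one, because beyond \<open>I\<close>
  both recursions see equal boundary values. So a canonical section is also the canonical section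
  through each of its values over a larger index.\<close>

lemma canon_canon:
  assumes "J \<subseteq> I" "I \<subseteq> N" "a \<in> D J" "K \<subseteq> N"
  shows "canon I (canon J a I) K = canon J a K"
  using \<open>K \<subseteq> N\<close>
proof (induction K rule: subset_N_induct)
  case (psubset K)
  show ?case
  proof (cases "K \<subseteq> I")
    case True
    then show ?thesis using assms by (simp add: canon_below canon_restr)
  next
    case False
    then have "\<not> K \<subseteq> J" using assms by auto
    then show ?thesis using False psubset by (auto simp: canon_lift intro!: lift_cong)
  qed
qed

section \<open>The inflation poset, its canonical cones and their union\<close>

abbreviation elements :: "(nat set \<times> 'b) set" where
  "elements \<equiv> {(J, e). J \<subseteq> N \<and> J \<noteq> {} \<and> e \<in> D J}"

sublocale finite_order elements "inflation_le r"
proof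
  have "elements \<subseteq> (SIGMA J:Pow N. D J)" by auto
  then show "finite elements"
    using finite_N finite_D by (rule_tac finite_subset) (auto intro!: finite_SigmaI)
  show "inflation_le r x x" if "x \<in> elements" for x
    using that restr_id by (auto simp: inflation_le_def)
  show "inflation_le r x z"
    if "x \<in> elements" "y \<in> elements" "z \<in> elements" "inflation_le r x y" "inflation_le r y z" for x y z
    using that restr_restr[of "fst x" "fst y" "fst z" "snd z"] by (auto simp: inflation_le_def)
  show "x = y" if "x \<in> elements" "y \<in> elements" "inflation_le r x y" "inflation_le r y x" for x y
    using that restr_id by (auto simp: inflation_le_def)
qed

definition canon_cone :: "nat \<Rightarrow> (nat set \<times> 'b) set" where
  "canon_cone i = {(J, e) \<in> elements. canon (J - {i}) (r J (J - {i}) e) J = e}"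

definition join :: "nat \<Rightarrow> nat set \<times> 'b \<Rightarrow> nat set \<times> 'b" where
  "join i x = (insert i (fst x), canon (fst x) (snd x) (insert i (fst x)))"

definition apex :: "nat \<Rightarrow> nat set \<times> 'b" where
  "apex i = ({i}, canon {} pt {i})"

text \<open>Here \<open>J - {i} = J\<close>, and every element is its own canonical
  extension.\<close>

lemma mem_cone_if_notin: "(J, e) \<in> elements \<Longrightarrow> i \<notin> J \<Longrightarrow> (J, e) \<in> canon_cone i"
  by (auto simp: canon_cone_def restr_id canon_self)

text \<open>This makes the cones subcomplexes. The restriction of \<open>e\<close> to
  \<open>L\<close> is a value of the section through the restriction to \<open>J - {i}\<close>, and
  by locality the part over \<open>L - {i}\<close> already determines that value.\<close>

lemma cone_lower:
  assumes x: "x \<in> canon_cone i" and y: "y \<in> elements" "inflation_le r y x"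
  shows "y \<in> canon_cone i"
proof -
  obtain J e L d where [simp]: "x = (J, e)" "y = (L, d)" by (metis surj_pair)
  have J: "J \<subseteq> N" "e \<in> D J" "canon (J - {i}) (r J (J - {i}) e) J = e"
    and L: "L \<subseteq> J" "L \<noteq> {}" "d \<in> D L" and d: "d = r J L e"
    using x y by (auto simp: canon_cone_def inflation_le_def)
  let ?a = "r J (J - {i}) e"
  have a: "?a \<in> D (J - {i})" using J restr_in by auto
  have "d = canon (J - {i}) ?a L" using canon_restr[of "J - {i}" ?a J L] J a L d by auto
  also have "\<dots> = canon ((J - {i}) \<inter> L) (r (J - {i}) ((J - {i}) \<inter> L) ?a) L"
    using J a L by (intro canon_Int) auto
  also have "r (J - {i}) ((J - {i}) \<inter> L) ?a = r L ((J - {i}) \<inter> L) d"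
    unfolding d using J L by (subst (1 2) restr_restr) auto
  also have "(J - {i}) \<inter> L = L - {i}" using L by auto
  finally show ?thesis using y by (simp add: canon_cone_def)
qed

lemma join_cone_eq: "x \<in> canon_cone i \<Longrightarrow> i \<in> fst x \<Longrightarrow> join i x = x"
  by (auto simp: canon_cone_def join_def insert_absorb canon_self)

lemma join_in_elements: "i \<in> N \<Longrightarrow> x \<in> elements \<Longrightarrow> join i x \<in> elements"
  by (auto simp: join_def canon_in)

lemma le_join: "i \<in> N \<Longrightarrow> x \<in> elements \<Longrightarrow> inflation_le r x (join i x)"
  by (auto simp: join_def inflation_le_def canon_restr[OF _ _ _ subset_insertI] canon_self)

text \<open>The deformation of cone \<open>i\<close> must respect the other cones. By extension in
  stages, the value over \<open>insert i J\<close> is canonical from \<open>J - {j}\<close>, and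
  therefore also from the intermediate index \<open>insert i J - {j}\<close>.\<close>

lemma join_in_cone:
  assumes i: "i \<in> N" and x: "x \<in> canon_cone i" "x \<in> canon_cone j"
  shows "join i x \<in> canon_cone j"
proof (cases "i \<in> fst x")
  case True
  then show ?thesis using join_cone_eq x by simp
next
  case False
  obtain J e where [simp]: "x = (J, e)" by (metis surj_pair)
  have J: "J \<subseteq> N" "e \<in> D J" "canon (J - {j}) (r J (J - {j}) e) J = e" "i \<notin> J"
    using x False by (auto simp: canon_cone_def)
  let ?a = "r J (J - {j}) e" and ?I = "insert i J"
  have a: "?a \<in> D (J - {j})" using J restr_in by auto
  have I: "?I \<subseteq> N" using i J by auto
  have e': "canon J e K = canon (J - {j}) ?a K" if "K \<subseteq> N" for K
    using canon_canon[of "J - {j}" J ?a K] J a that by auto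
  have "canon (?I - {j}) (r ?I (?I - {j}) (canon J e ?I)) ?I = canon J e ?I"
  proof (cases "i = j")
    case True
    then have "?I - {j} = J" using J by auto
    moreover have "r ?I J (canon J e ?I) = e"
      using J I canon_restr[OF _ _ _ subset_insertI] canon_self by auto
    ultimately show ?thesis by simp
  next
    case False
    have "r ?I (?I - {j}) (canon J e ?I) = canon (J - {j}) ?a (?I - {j})"
    proof -
      have "?I - {j} \<subseteq> N" using I by auto
      then show ?thesis using canon_restr[OF J(1,2) I Diff_subset] e'[of "?I - {j}"] by simp
    qed
    moreover have "canon (?I - {j}) (canon (J - {j}) ?a (?I - {j})) ?I = canon (J - {j}) ?a ?I"
      using I a by (intro canon_canon) auto
    ultimately show ?thesis using e'[OF I] by simp
  qed
  then show ?thesis using join_in_elements[OF i, of x] x by (simp add: canon_cone_def join_def)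
qed

text \<open>The delicate case has \<open>i\<close> in the larger index only. Then \<open>y\<close>
  already has a value over \<open>insert i L\<close>, and membership of \<open>y\<close> in the cone
  forces it to be the canonical one.\<close>

lemma join_mono:
  assumes i: "i \<in> N" and x: "x \<in> canon_cone i" and y: "y \<in> canon_cone i" and le: "inflation_le r x y"
  shows "inflation_le r (join i x) (join i y)"
proof -
  obtain J e L d where [simp]: "y = (J, e)" "x = (L, d)" by (metis surj_pair)
  have J: "J \<subseteq> N" "e \<in> D J" and L: "L \<subseteq> J" "d = r J L e"
    using x y le by (auto simp: canon_cone_def inflation_le_def)
  show ?thesis
  proof (cases "i \<in> J")
    case True
    then have y': "join i y = y" using join_cone_eq[OF y] by simp
    show ?thesis
    proof (cases "i \<in> L")
      case False
      let ?a = "r J (J - {i}) e"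
      have a: "?a \<in> D (J - {i})" "L \<subseteq> J - {i}" "canon (J - {i}) ?a J = e"
        using J L False restr_in y by (auto simp: canon_cone_def)
      have "r J (insert i L) e = canon (J - {i}) ?a (insert i L)"
        using canon_restr[of "J - {i}" ?a J "insert i L"] J a L True by auto
      also have "\<dots> = canon ((J - {i}) \<inter> insert i L) (r (J - {i}) ((J - {i}) \<inter> insert i L) ?a) (insert i L)"
        using J a L True by (intro canon_Int) auto
      also have "(J - {i}) \<inter> insert i L = L" using a by auto
      also have "r (J - {i}) L ?a = d" using J a L by (simp add: restr_restr)
      finally show ?thesis using True L unfolding y' by (auto simp: join_def inflation_le_def)
    qed (use le y' join_cone_eq[OF x] in simp)
  next
    case False
    let ?I = "insert i J"
    have I: "?I \<subseteq> N" using i J by auto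
    have "r ?I (insert i L) (canon J e ?I) = canon J e (insert i L)"
      using J I L by (intro canon_restr) auto
    also have "\<dots> = canon (J \<inter> insert i L) (r J (J \<inter> insert i L) e) (insert i L)"
      using J I L by (intro canon_Int) auto
    also have "J \<inter> insert i L = L" using L False by auto
    finally show ?thesis using L by (auto simp: join_def inflation_le_def)
  qed
qed

lemma pt_in: "pt \<in> D {}" by (simp add: D_empty)

lemma apex_in_elements: "i \<in> N \<Longrightarrow> apex i \<in> elements"
  using canon_in[OF _ pt_in, of "{i}"] by (auto simp: apex_def)

lemma restr_empty: "J \<subseteq> N \<Longrightarrow> e \<in> D J \<Longrightarrow> r J {} e = pt"
  using restr_in[of "{}" J e] D_empty by auto

lemma apex_in_cone: "i \<in> N \<Longrightarrow> apex i \<in> canon_cone j"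
proof (cases "i = j")
  case True
  assume "i \<in> N"
  then have "canon {} pt {i} \<in> D {i}" using canon_in[OF _ pt_in] by auto
  then show ?thesis using \<open>i \<in> N\<close> True by (simp add: canon_cone_def apex_def restr_empty)
next
  case False
  assume "i \<in> N"
  then show ?thesis using apex_in_elements mem_cone_if_notin[of "{i}" "canon {} pt {i}" j] False
    by (auto simp: apex_def)
qed

text \<open>Locality at \<open>{i}\<close>: the value there is determined by the restriction to the
  empty set, whose fibre is one point. Hence it is the same for all \<open>x\<close>.\<close>

lemma apex_le_join:
  assumes i: "i \<in> N" and x: "x \<in> canon_cone i"
  shows "inflation_le r (apex i) (join i x)"
proof -
  have "inflation_le r (apex i) y" if "y = join i x" "y \<in> canon_cone i" for y
  proof -
    obtain J e where [simp]: "y = (J, e)" by (metis surj_pair)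
    have J: "J \<subseteq> N" "e \<in> D J" "canon (J - {i}) (r J (J - {i}) e) J = e" "i \<in> J"
      using that by (auto simp: canon_cone_def join_def)
    let ?a = "r J (J - {i}) e"
    have a: "?a \<in> D (J - {i})" using J restr_in by auto
    have "r J {i} e = canon (J - {i}) ?a {i}"
      using canon_restr[of "J - {i}" ?a J "{i}"] J a by auto
    also have "\<dots> = canon ((J - {i}) \<inter> {i}) (r (J - {i}) ((J - {i}) \<inter> {i}) ?a) {i}"
      using J a by (intro canon_Int) auto
    also have "(J - {i}) \<inter> {i} = {}" by auto
    also have "r (J - {i}) {} ?a = pt" using J a by (intro restr_empty) auto
    finally show ?thesis using J by (simp add: apex_def inflation_le_def)
  qed
  then show ?thesis using join_in_cone[OF i x x] by blast
qed

lemma cone_subset: "canon_cone i \<subseteq> elements"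
  by (auto simp: canon_cone_def)

text \<open>The cone is glued onto its own apex, a one-vertex subcomplex, so that the gluing lemma
  also covers a single cone.\<close>

lemma contractible_cone:
  assumes i: "i \<in> N"
  shows "contractible (chain_points (canon_cone i) (inflation_le r))"
proof -
  let ?a = "apex i"
  have "chain_points {?a} (inflation_le r) = {\<lambda>x. if x = ?a then 1 else 0}"
    using finite_order.le_refl[OF finite_order_axioms apex_in_elements[OF i]]
    by (auto simp: chain_points_def fun_eq_iff)
  moreover have "contractible {c}" for c :: "nat set \<times> 'b \<Rightarrow> real"
    unfolding contractible_def by (intro exI[of _ c] homotopic_with_equal) auto
  ultimately have 1: "contractible (chain_points {?a} (inflation_le r))" by simp
  \<comment> \<open>The apex alone is a lower set, since a singleton is minimal among nonempty
    indices.\<close>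
  have 2: "y = ?a" if "y \<in> elements" "inflation_le r y ?a" for y
  proof -
    have "fst y = {i}" using that by (auto simp: inflation_le_def apex_def)
    then show ?thesis
      using that restr_id[of "{i}" "snd ?a"] apex_in_elements[OF i] by (auto simp: inflation_le_def apex_def)
  qed
  have 3: "join i ?a = ?a" using join_cone_eq[OF apex_in_cone[OF i]] by (simp add: apex_def)
  have "contractible (chain_points ({?a} \<union> canon_cone i) (inflation_le r))"
  proof (rule contractible_chain_points_Un_cone[of _ _ "join i" ?a])
    show "inflation_le r x (join i x)" if "x \<in> canon_cone i" for x using le_join[OF i] that cone_subset by blast
  qed (use i 1 2 3 apex_in_elements apex_in_cone cone_subset cone_lower join_in_cone join_mono apex_le_join in auto)
  then show ?thesis using apex_in_cone[OF i] by (simp add: insert_absorb)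
qed

text \<open>\<open>join i\<close> preserves every cone, hence also the overlap of the new cone with
  all previous ones; and \<open>apex i\<close> lies in every cone, so the overlap contains
  it.\<close>

lemma contractible_UN_cone:
  assumes "finite F" "F \<noteq> {}" "F \<subseteq> N"
  shows "contractible (chain_points (\<Union>i\<in>F. canon_cone i) (inflation_le r))"
  using assms
proof (induction rule: finite_ne_induct)
  case (singleton i)
  then show ?case using contractible_cone by simp
next
  case (insert i F)
  let ?A = "\<Union>j\<in>F. canon_cone j"
  have i: "i \<in> N" using insert by simp
  have "contractible (chain_points (?A \<union> canon_cone i) (inflation_le r))"
  proof (rule contractible_chain_points_Un_cone[of _ _ "join i" "apex i"])
    show "?A \<subseteq> elements" "canon_cone i \<subseteq> elements" using cone_subset by auto
    show "contractible (chain_points ?A (inflation_le r))" using insert by simp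
    show "y \<in> ?A" if "x \<in> ?A" "y \<in> elements" "inflation_le r y x" for x y
      using that cone_lower by blast
    show "y \<in> canon_cone i" if "x \<in> canon_cone i" "y \<in> elements" "inflation_le r y x" for x y
      using that cone_lower by blast
    show "join i x \<in> canon_cone i" if "x \<in> canon_cone i" for x using that join_in_cone[OF i] by blast
    show "join i x \<in> ?A" if "x \<in> ?A" "x \<in> canon_cone i" for x using that join_in_cone[OF i] by blast
    show "inflation_le r (join i x) (join i y)" if "x \<in> canon_cone i" "y \<in> canon_cone i" "inflation_le r x y" for x y
      using that join_mono[OF i] by blast
    show "inflation_le r x (join i x)" if "x \<in> canon_cone i" for x
      using le_join[OF i] that cone_subset by blast
    show "apex i \<in> ?A" "apex i \<in> canon_cone i" using apex_in_cone[OF i] insert.hyps by auto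
    show "inflation_le r (apex i) (join i x)" if "x \<in> canon_cone i" for x using that apex_le_join[OF i] by blast
  qed
  then show ?case by (simp add: Un_commute)
qed

definition essential :: "(nat set \<times> 'b) set" where
  "essential = elements - (\<Union>i\<in>N. canon_cone i)"

lemma essential_top: "x \<in> essential \<Longrightarrow> fst x = N"
  using mem_cone_if_notin[of "fst x" "snd x"] by (fastforce simp: essential_def)

lemma contractible_inessential:
  assumes "N \<noteq> {}"
  shows "contractible (chain_points (elements - essential) (inflation_le r))"
proof -
  have "elements - essential = (\<Union>i\<in>N. canon_cone i)" using cone_subset by (auto simp: essential_def)
  then show ?thesis using contractible_UN_cone[OF finite_N assms] by simp
qed

end

section \<open>From a barycentric simplex to the sphere\<close>

text \<open>Barycentric coordinates in the subdivided simplex on \<open>N\<close>, with total mass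
  left free so that mass can be peeled off inductively.\<close>

definition chain_weights :: "'i set \<Rightarrow> ('i set \<Rightarrow> real) \<Rightarrow> bool" where
  "chain_weights N h \<longleftrightarrow> h {} = 0 \<and> (\<forall>I\<subseteq>N. 0 \<le> h I) \<and>
     (\<forall>I\<subseteq>N. \<forall>J\<subseteq>N. 0 < h I \<longrightarrow> 0 < h J \<longrightarrow> I \<subseteq> J \<or> J \<subseteq> I)"

text \<open>The heights are the coordinates of the vector sum of the \<open>h I\<close> times the indicator functions of the
  \<open>I\<close>. For chain weights they determine \<open>h\<close>; their minimum is \<open>h N\<close> and their maximum the
  total weight, so the boundary of the simplex is where some height vanishes.\<close>
definition height :: "'i set \<Rightarrow> ('i set \<Rightarrow> real) \<Rightarrow> 'i \<Rightarrow> real" where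
  "height N h a = (\<Sum>I\<in>{I. I \<subseteq> N \<and> a \<in> I}. h I)"

lemma finite_faces: "finite N \<Longrightarrow> finite {I. I \<subseteq> N \<and> P I}"
  by (rule finite_subset[of _ "Pow N"]) auto

text \<open>A nonempty finite set covered by a chain lies in one of its members.\<close>

lemma ex_notin_chain:
  assumes "finite M" "M \<noteq> {}" "\<And>I J. I \<in> C \<Longrightarrow> J \<in> C \<Longrightarrow> I \<subseteq> J \<or> J \<subseteq> I" "\<And>I. I \<in> C \<Longrightarrow> \<not> M \<subseteq> I"
  shows "\<exists>a\<in>M. \<forall>I\<in>C. a \<notin> I"
proof (rule ccontr)
  assume "\<not> ?thesis"
  then have "M \<subseteq> \<Union> C" "C \<noteq> {}" using assms(2) by auto
  moreover have "subset.chain UNIV C" using assms(3) by (auto simp: subset_chain_def)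
  ultimately obtain I where "I \<in> C" "M \<subseteq> I"
    using finite_subset_Union_chain[OF assms(1), of C UNIV] by blast
  then show False using assms(4) by blast
qed

context
  fixes N :: "'i set" and h :: "'i set \<Rightarrow> real"
  assumes N: "finite N" "N \<noteq> {}" and h: "chain_weights N h"
begin

lemma height_ge: "I \<subseteq> N \<Longrightarrow> a \<in> I \<Longrightarrow> h I \<le> height N h a"
  unfolding height_def using h by (intro member_le_sum finite_faces N) (auto simp: chain_weights_def)

lemma height_le: "height N h a \<le> sum h (Pow N)"
  unfolding height_def using h N by (intro sum_mono2) (auto simp: chain_weights_def)

text \<open>Any point of the smallest face of positive weight lies in all faces of positive
  weight.\<close>

lemma ex_height_eq_total: "\<exists>a\<in>N. height N h a = sum h (Pow N)"
proof (cases "{I. I \<subseteq> N \<and> 0 < h I} = {}")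
  case True
  then have "h I = 0" if "I \<subseteq> N" for I using h that by (auto simp: chain_weights_def less_le)
  then show ?thesis using N by (auto simp: height_def)
next
  case False
  then obtain M where M: "M \<subseteq> N" "0 < h M" "\<And>I. I \<subseteq> N \<Longrightarrow> 0 < h I \<Longrightarrow> I \<subseteq> M \<Longrightarrow> M = I"
    using finite_has_minimal[OF finite_faces[OF N(1)] False] by auto
  then have "M \<noteq> {}" using h by (auto simp: chain_weights_def)
  then obtain a where a: "a \<in> M" by blast
  have "h I = 0" if "I \<subseteq> N" "a \<notin> I" for I
  proof (rule ccontr)
    assume "h I \<noteq> 0"
    then have "0 < h I" using h that by (auto simp: chain_weights_def less_le)
    then have "I \<subseteq> M \<or> M \<subseteq> I" using h M that by (auto simp: chain_weights_def)
    then show False using M(3)[of I] that \<open>0 < h I\<close> a by auto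
  qed
  then have "height N h a = sum h (Pow N)"
    unfolding height_def using N by (intro sum.mono_neutral_left) auto
  then show ?thesis using a M by blast
qed

text \<open>The proper faces of positive weight form a chain and so miss a common point of
  \<open>N\<close>, whose height then comes from \<open>N\<close> alone.\<close>

lemma ex_height_eq_top: "\<exists>a\<in>N. height N h a = h N"
proof -
  have "\<exists>a\<in>N. \<forall>I\<in>{I. I \<subseteq> N \<and> 0 < h I \<and> I \<noteq> N}. a \<notin> I"
    by (rule ex_notin_chain[OF N]) (use h in \<open>auto simp: chain_weights_def\<close>)
  then obtain a where a: "a \<in> N" "\<And>I. I \<subseteq> N \<Longrightarrow> 0 < h I \<Longrightarrow> I \<noteq> N \<Longrightarrow> a \<notin> I" by blast
  have "height N h a = sum h {N}"
    unfolding height_def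
  proof (rule sum.mono_neutral_right)
    show "\<forall>I\<in>{I. I \<subseteq> N \<and> a \<in> I} - {N}. h I = 0"
    proof
      fix I assume I: "I \<in> {I. I \<subseteq> N \<and> a \<in> I} - {N}"
      then have "\<not> 0 < h I" "0 \<le> h I" using a(2)[of I] h by (auto simp: chain_weights_def)
      then show "h I = 0" by simp
    qed
  qed (use a N in \<open>auto intro: finite_faces\<close>)
  then show ?thesis using a by auto
qed

text \<open>A face of positive weight through \<open>b\<close> is comparable with \<open>I\<close>
  but not inside it, so it contains \<open>I\<close> and thus \<open>a\<close>. The face
  \<open>I\<close> itself contributes to \<open>a\<close> only.\<close>

lemma height_strict: "I \<subseteq> N \<Longrightarrow> 0 < h I \<Longrightarrow> a \<in> I \<Longrightarrow> b \<in> N - I \<Longrightarrow> height N h b < height N h a"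
proof -
  assume I: "I \<subseteq> N" "0 < h I" "a \<in> I" "b \<in> N - I"
  have "height N h b \<le> sum h ({K. K \<subseteq> N \<and> a \<in> K} - {I})"
  proof -
    have "height N h b = sum h {K. K \<subseteq> N \<and> b \<in> K \<and> a \<in> K}"
      unfolding height_def
    proof (rule sum.mono_neutral_right)
      show "\<forall>K\<in>{K. K \<subseteq> N \<and> b \<in> K} - {K. K \<subseteq> N \<and> b \<in> K \<and> a \<in> K}. h K = 0"
      proof
        fix K assume K: "K \<in> {K. K \<subseteq> N \<and> b \<in> K} - {K. K \<subseteq> N \<and> b \<in> K \<and> a \<in> K}"
        then have "\<not> (K \<subseteq> I \<or> I \<subseteq> K)" using I by auto
        moreover have "K \<subseteq> N" using K by auto
        ultimately have "\<not> 0 < h K" "0 \<le> h K" using h I(1,2) unfolding chain_weights_def by blast+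
        then show "h K = 0" by simp
      qed
    qed (use N in \<open>auto intro: finite_faces\<close>)
    also have "\<dots> \<le> sum h ({K. K \<subseteq> N \<and> a \<in> K} - {I})"
      using h I N by (intro sum_mono2) (auto simp: chain_weights_def intro: finite_faces)
    finally show ?thesis .
  qed
  also have "\<dots> = height N h a - h I"
    unfolding height_def using I N by (subst sum_diff1) (auto intro: finite_faces)
  finally show ?thesis using I by simp
qed

end

text \<open>Strict height comparisons show that the two supports together form a chain. In a maximal
  face \<open>M\<close> of disagreement there is a point avoided by all other such faces, and at
  that point the heights differ by exactly \<open>h M - g M\<close>.\<close>

lemma chain_weights_eqI:
  assumes N: "finite N" and h: "chain_weights N h" and g: "chain_weights N g"
    and eq: "\<And>a. a \<in> N \<Longrightarrow> height N h a = height N g a" and "I \<subseteq> N"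
  shows "h I = g I"
proof (cases "N = {}")
  case True
  then show ?thesis using h g \<open>I \<subseteq> N\<close> by (auto simp: chain_weights_def)
next
  case False
  define C where "C = {I. I \<subseteq> N \<and> (0 < h I \<or> 0 < g I)}"
  have mixed: "I \<subseteq> J \<or> J \<subseteq> I" if IJ: "I \<subseteq> N" "J \<subseteq> N" "0 < h I" "0 < g J" for I J
  proof (rule ccontr)
    assume "\<not> ?thesis"
    then obtain a b where ab: "a \<in> I" "a \<in> N - J" "b \<in> J" "b \<in> N - I" using IJ by blast
    then have "height N h b < height N h a" "height N g a < height N g b"
      using height_strict[OF N False h, of I a b] height_strict[OF N False g, of J b a] IJ by auto
    then show False using eq[of a] eq[of b] ab by auto
  qed
  have chain: "I \<subseteq> J \<or> J \<subseteq> I" if "I \<in> C" "J \<in> C" for I J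
  proof -
    have "I \<subseteq> N" "J \<subseteq> N" using that by (auto simp: C_def)
    moreover have "I \<subseteq> J \<or> J \<subseteq> I" if "chain_weights N f" "0 < f I" "0 < f J" for f
      using that calculation by (auto simp: chain_weights_def)
    ultimately show ?thesis using that mixed[of I J] mixed[of J I] h g by (auto simp: C_def)
  qed
  define E where "E = {I\<in>C. h I \<noteq> g I}"
  have "E = {}"
  proof (rule ccontr)
    assume "E \<noteq> {}"
    moreover have "finite E" unfolding E_def C_def using N by (auto intro: finite_faces)
    ultimately obtain M where M: "M \<in> E" "\<And>I. I \<in> E \<Longrightarrow> M \<subseteq> I \<Longrightarrow> M = I"
      using finite_has_maximal[of E] by auto
    have MN: "M \<subseteq> N" "M \<noteq> {}" using M(1) h g by (auto simp: E_def C_def chain_weights_def)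
    obtain a where a: "a \<in> M" "\<forall>I\<in>E - {M}. a \<notin> I"
      using ex_notin_chain[of M "E - {M}"] chain M MN finite_subset[OF _ N] unfolding E_def by blast
    have "(\<Sum>I\<in>{I. I \<subseteq> N \<and> a \<in> I}. h I - g I) = (\<Sum>I\<in>{M}. h I - g I)"
    proof (rule sum.mono_neutral_right)
      show "\<forall>I\<in>{I. I \<subseteq> N \<and> a \<in> I} - {M}. h I - g I = 0"
      proof
        fix I assume I: "I \<in> {I. I \<subseteq> N \<and> a \<in> I} - {M}"
        then have "I \<notin> E" using a by blast
        moreover have "0 \<le> h I" "0 \<le> g I" using I h g by (auto simp: chain_weights_def)
        ultimately show "h I - g I = 0" using I unfolding E_def C_def by auto
      qed
    qed (use a MN N in \<open>auto intro: finite_faces\<close>)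
    moreover have "a \<in> N" using a MN by auto
    ultimately show False using eq[of a] M(1) by (simp add: height_def sum_subtractf E_def)
  qed
  moreover have "0 \<le> h I" "0 \<le> g I" using \<open>I \<subseteq> N\<close> h g by (auto simp: chain_weights_def)
  ultimately show ?thesis using \<open>I \<subseteq> N\<close> unfolding E_def C_def by force
qed

text \<open>Layer-cake decomposition: the least positive value \<open>m\<close> of \<open>y\<close>
  becomes the weight of the support \<open>A\<close>, and subtracting it there leaves a smaller
  support.\<close>

lemma ex_chain_weights:
  assumes N: "finite N" and y: "\<And>a. a \<in> N \<Longrightarrow> 0 \<le> y a"
  shows "\<exists>h. chain_weights N h \<and> (\<forall>a\<in>N. height N h a = y a)"
proof -
  have "finite {a\<in>N. y a \<noteq> 0}" using N by simp
  then show ?thesis using y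
  proof (induction "{a\<in>N. y a \<noteq> 0}" arbitrary: y rule: finite_psubset_induct)
    case psubset
    define A where "A = {a\<in>N. y a \<noteq> 0}"
    show ?case
    proof (cases "A = {}")
      case True
      then show ?thesis
        by (intro exI[of _ "\<lambda>_. 0"]) (auto simp: chain_weights_def height_def A_def)
    next
      case False
      have fA: "finite A" using N by (simp add: A_def)
      define m where "m = Min (y ` A)"
      have "m \<in> y ` A" unfolding m_def using False fA by (intro Min_in) auto
      then obtain a0 where a0: "a0 \<in> A" "y a0 = m" by auto
      have m: "m \<le> y a" if "a \<in> A" for a using that fA by (auto simp: m_def)
      have m0: "0 < m" using a0 psubset.prems by (auto simp: A_def less_le)
      define z where "z = (\<lambda>a. if a \<in> A then y a - m else 0)"
      have "{a\<in>N. z a \<noteq> 0} \<subset> {a\<in>N. y a \<noteq> 0}"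
        using a0 by (auto simp: z_def A_def)
      moreover have z0: "0 \<le> z a" if "a \<in> N" for a using m by (auto simp: z_def)
      ultimately obtain h where h: "chain_weights N h" "\<And>a. a \<in> N \<Longrightarrow> height N h a = z a"
        using psubset.hyps(2)[of z] by blast
      have NN: "N \<noteq> {}" using a0 by (auto simp: A_def)
      have AN: "A \<subseteq> N" by (auto simp: A_def)
      have sub: "I \<subseteq> A" if "I \<subseteq> N" "0 < h I" for I
      proof
        fix a assume "a \<in> I"
        then have "0 < z a" using height_ge[OF N NN h(1) that(1), of a] h(2)[of a] that by auto
        then show "a \<in> A" by (auto simp: z_def split: if_splits)
      qed
      define h' where "h' = (\<lambda>I. h I + (if I = A then m else 0))"
      have "chain_weights N h'"
        unfolding chain_weights_def
      proof (intro conjI allI impI)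
        show "h' {} = 0" using False h(1) by (auto simp: h'_def chain_weights_def)
        show "0 \<le> h' I" if "I \<subseteq> N" for I using that h(1) m0 by (auto simp: h'_def chain_weights_def)
        fix I J assume IJ: "I \<subseteq> N" "J \<subseteq> N" "0 < h' I" "0 < h' J"
        then consider "I = A" "J \<subseteq> A" | "J = A" "I \<subseteq> A" | "0 < h I" "0 < h J"
          using sub[of I] sub[of J] by (auto simp: h'_def split: if_splits)
        then show "I \<subseteq> J \<or> J \<subseteq> I"
        proof cases
          case 3
          then show ?thesis using IJ h(1) by (auto simp: chain_weights_def)
        qed auto
      qed
      moreover have "height N h' a = y a" if a: "a \<in> N" for a
      proof -
        have "height N h' a = height N h a + (\<Sum>I\<in>{I. I \<subseteq> N \<and> a \<in> I}. if I = A then m else 0)"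
          by (simp add: height_def h'_def sum.distrib)
        also have "(\<Sum>I\<in>{I. I \<subseteq> N \<and> a \<in> I}. if I = A then m else 0) = (if a \<in> A then m else 0)"
          using AN finite_faces[OF N, of "\<lambda>I. a \<in> I"] by simp
        finally show ?thesis using h(2)[OF a] a by (auto simp: z_def A_def)
      qed
      ultimately show ?thesis by blast
    qed
  qed
qed

section \<open>Stereographic coordinates on the open simplex\<close>

text \<open>Inverse stereographic projection of the vector with coordinates \<open>(height a - height b) / h N\<close> (\<open>a \<noteq> b\<close>),
  multiplied out so that it stays defined on the boundary \<open>h N = 0\<close>, where it is \<open>0\<close>.\<close>
definition sphere_denom :: "'i set \<Rightarrow> 'i \<Rightarrow> ('i set \<Rightarrow> real) \<Rightarrow> real" where
  "sphere_denom N b h = (h N)\<^sup>2 + (\<Sum>a\<in>N. (height N h a - height N h b)\<^sup>2)"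

definition sphere_coord :: "'i set \<Rightarrow> 'i \<Rightarrow> ('i set \<Rightarrow> real) \<Rightarrow> 'i \<Rightarrow> real" where
  "sphere_coord N b h a = 2 * h N * (if a = b then h N else height N h a - height N h b) / sphere_denom N b h"

text \<open>The heights range from \<open>h N\<close> up to the total weight 1, so they cannot all
  coincide when \<open>h N = 0\<close>.\<close>

lemma sphere_denom_pos:
  assumes N: "finite N" "b \<in> N" and h: "chain_weights N h" "sum h (Pow N) = 1"
  shows "0 < sphere_denom N b h"
proof (rule ccontr)
  assume "\<not> ?thesis"
  moreover have "0 \<le> (\<Sum>a\<in>N. (height N h a - height N h b)\<^sup>2)" by (intro sum_nonneg) auto
  ultimately have z: "(h N)\<^sup>2 = 0" "(\<Sum>a\<in>N. (height N h a - height N h b)\<^sup>2) = 0"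
    unfolding sphere_denom_def by (smt (verit) zero_le_power2)+
  have eq: "height N h a = height N h b" if "a \<in> N" for a
    using sum_nonneg_0[OF N(1) _ z(2) that] by simp
  have "N \<noteq> {}" using N by auto
  then obtain a c where "a \<in> N" "height N h a = 1" "c \<in> N" "height N h c = h N"
    using ex_height_eq_total[OF N(1) _ h(1)] ex_height_eq_top[OF N(1) _ h(1)] h(2) by metis
  then show False using eq[of a] eq[of c] z(1) by simp
qed

text \<open>This is the expanded equation of the unit sphere centred at the basis vector of
  \<open>b\<close>.\<close>

lemma sphere_coord_on_sphere:
  assumes N: "finite N" "b \<in> N" and h: "0 < h N"
  shows "(\<Sum>a\<in>N. (sphere_coord N b h a)\<^sup>2) = 2 * sphere_coord N b h b"
proof -
  let ?d = "\<lambda>a. height N h a - height N h b" and ?q = "sphere_denom N b h"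
  have "0 \<le> (\<Sum>a\<in>N. (?d a)\<^sup>2)" by (intro sum_nonneg) auto
  then have q: "0 < ?q" unfolding sphere_denom_def using h by (simp add: add_pos_nonneg)
  have "(\<Sum>a\<in>N. (if a = b then h N else ?d a)\<^sup>2) = (h N)\<^sup>2 + (\<Sum>a\<in>N - {b}. (?d a)\<^sup>2)"
    using N by (subst sum.remove[of N b]) auto
  also have "(\<Sum>a\<in>N - {b}. (?d a)\<^sup>2) = (\<Sum>a\<in>N. (?d a)\<^sup>2)"
    using N by (intro sum.mono_neutral_left) auto
  finally have s: "(\<Sum>a\<in>N. (if a = b then h N else ?d a)\<^sup>2) = ?q" by (simp add: sphere_denom_def)
  have "(\<Sum>a\<in>N. (sphere_coord N b h a)\<^sup>2) = (2 * h N / ?q)\<^sup>2 * (\<Sum>a\<in>N. (if a = b then h N else ?d a)\<^sup>2)"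
    unfolding sum_distrib_left by (intro sum.cong) (auto simp: sphere_coord_def power_divide power_mult_distrib)
  also have "\<dots> = 2 * sphere_coord N b h b"
    unfolding s sphere_coord_def using q by (simp add: power2_eq_square)
  finally show ?thesis .
qed

text \<open>Quotients of coordinates recover the heights up to shift and scale. The shift is fixed
  because the minimal height is \<open>h N\<close>, the scale because the maximal height is
  1.\<close>

lemma sphere_coord_inj:
  assumes N: "finite N" "b \<in> N"
    and h: "chain_weights N h" "sum h (Pow N) = 1" "0 < h N"
    and g: "chain_weights N g" "sum g (Pow N) = 1" "0 < g N"
    and eq: "\<And>a. a \<in> N \<Longrightarrow> sphere_coord N b h a = sphere_coord N b g a" and I: "I \<subseteq> N"
  shows "h I = g I"
proof -
  have NN: "N \<noteq> {}" using N by auto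
  have ratio: "sphere_coord N b f a / sphere_coord N b f b = (height N f a - height N f b) / f N"
    if "chain_weights N f" "sum f (Pow N) = 1" "0 < f N" "a \<noteq> b" for f a
    using sphere_denom_pos[OF N that(1,2)] that(3,4) by (simp add: sphere_coord_def field_simps power2_eq_square)
  have w: "(height N h a - height N h b) / h N = (height N g a - height N g b) / g N" if "a \<in> N" for a
    using ratio[OF h, of a] ratio[OF g, of a] eq[OF that] eq[OF N(2)] by (cases "a = b") auto
  have base_le: "height N f b / f N \<le> height N f' b / f' N"
    if f: "chain_weights N f" "0 < f N" and f': "chain_weights N f'" "0 < f' N"
      and w: "\<And>a. a \<in> N \<Longrightarrow> (height N f a - height N f b) / f N = (height N f' a - height N f' b) / f' N" for f f'
  proof -
    obtain a where a: "a \<in> N" "height N f a = f N" using ex_height_eq_top[OF N(1) NN f(1)] by auto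
    have "f' N \<le> height N f' a" using height_ge[OF N(1) NN f'(1)] a by auto
    then have "1 \<le> height N f' a / f' N" using f' by simp
    moreover have "height N f a / f N = 1" using a f by simp
    ultimately show ?thesis using w[OF a(1)] by (simp add: diff_divide_distrib)
  qed
  have "height N h b / h N = height N g b / g N"
    using base_le[OF h(1,3) g(1,3)] base_le[OF g(1,3) h(1,3)] w by force
  then have u: "height N h a / h N = height N g a / g N" if "a \<in> N" for a
    using w[OF that] by (simp add: diff_divide_distrib)
  have top_le: "f N \<le> f' N"
    if f: "chain_weights N f" "sum f (Pow N) = 1" "0 < f N" and f': "chain_weights N f'" "sum f' (Pow N) = 1" "0 < f' N"
      and u: "\<And>a. a \<in> N \<Longrightarrow> height N f a / f N = height N f' a / f' N" for f f'
  proof -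
    obtain a where a: "a \<in> N" "height N f' a = 1" using ex_height_eq_total[OF N(1) NN f'(1)] f' by auto
    have "height N f a \<le> 1" using height_le[OF N(1) NN f(1)] f by auto
    then have "1 / f' N \<le> 1 / f N" using u[OF a(1)] a(2) f(3) by (metis divide_right_mono less_imp_le)
    then show ?thesis using f(3) f'(3) by (simp add: field_simps)
  qed
  have "h N = g N" using top_le[OF h g] top_le[OF g h] u by force
  then have "height N h a = height N g a" if "a \<in> N" for a using u[OF that] h by simp
  then show ?thesis using chain_weights_eqI[OF N(1) h(1) g(1) _ I] by blast
qed

lemma sphere_coord_surj:
  fixes x :: "'i \<Rightarrow> real"
  assumes N: "finite N" "b \<in> N" and x: "(\<Sum>a\<in>N. (x a)\<^sup>2) = 2 * x b" "\<exists>a\<in>N. x a \<noteq> 0"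
  shows "\<exists>h. chain_weights N h \<and> sum h (Pow N) = 1 \<and> 0 < h N \<and> (\<forall>a\<in>N. sphere_coord N b h a = x a)"
proof -
  have NN: "N \<noteq> {}" using N by auto
  have xb: "0 < x b"
  proof -
    obtain a where a: "a \<in> N" "x a \<noteq> 0" using x(2) by blast
    have "0 < (x a)\<^sup>2" using a by simp
    also have "\<dots> \<le> (\<Sum>a\<in>N. (x a)\<^sup>2)" using a N by (intro member_le_sum) auto
    finally have "0 < (\<Sum>a\<in>N. (x a)\<^sup>2)" .
    then show ?thesis using x by simp
  qed
  \<comment> \<open>Undo the projection: \<open>w\<close> holds the height differences in units of
    the future \<open>h N\<close>, and \<open>u\<close> shifts them to minimum 1. Dividing by the
    maximum \<open>M\<close> then gives total weight 1 and \<open>h N = 1 / M\<close>.\<close>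
  define w where "w = (\<lambda>a. if a = b then 0 else x a / x b)"
  define u where "u = (\<lambda>a. 1 - Min (w ` N) + w a)"
  define M where "M = Max (u ` N)"
  have "Min (w ` N) \<in> w ` N" using N NN by (intro Min_in) auto
  then obtain c where c: "c \<in> N" "u c = 1" by (auto simp: u_def)
  have u1: "1 \<le> u a" if "a \<in> N" for a using that N by (auto simp: u_def)
  have "M \<in> u ` N" unfolding M_def using N NN by (intro Max_in) auto
  then obtain d where d: "d \<in> N" "u d = M" by auto
  have uM: "u a \<le> M" if "a \<in> N" for a using that N by (auto simp: M_def)
  have M: "1 \<le> M" using u1[OF d(1)] d by simp
  obtain h where h: "chain_weights N h" "\<And>a. a \<in> N \<Longrightarrow> height N h a = u a / M"
    using ex_chain_weights[OF N(1), of "\<lambda>a. u a / M"] u1 M by force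
  have total: "sum h (Pow N) = 1"
  proof -
    obtain a where a: "a \<in> N" "height N h a = sum h (Pow N)" using ex_height_eq_total[OF N(1) NN h(1)] by auto
    have "height N h d \<le> sum h (Pow N)" using height_le[OF N(1) NN h(1)] .
    moreover have "height N h a \<le> 1" using h(2)[OF a(1)] uM[OF a(1)] M by simp
    ultimately show ?thesis using a(2) h(2)[OF d(1)] d(2) M by simp
  qed
  have top: "h N = 1 / M"
  proof -
    obtain a where a: "a \<in> N" "height N h a = h N" using ex_height_eq_top[OF N(1) NN h(1)] by auto
    have "h N \<le> height N h c" using height_ge[OF N(1) NN h(1)] c by auto
    moreover have "1 / M \<le> u a / M" using u1[OF a(1)] M by (intro divide_right_mono) auto
    then have "1 / M \<le> h N" using a(2) h(2)[OF a(1)] by simp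
    ultimately show ?thesis using h(2)[OF c(1)] c(2) by simp
  qed
  have diff: "height N h a - height N h b = w a / M" if "a \<in> N" for a
    using h(2) that N(2) by (simp add: u_def w_def add_divide_distrib diff_divide_distrib)
  have "(\<Sum>a\<in>N. (w a)\<^sup>2) = (\<Sum>a\<in>N - {b}. (x a)\<^sup>2) / (x b)\<^sup>2"
    using N by (subst sum.remove[of N b]) (auto simp: w_def power_divide sum_divide_distrib intro!: sum.cong)
  also have "(\<Sum>a\<in>N - {b}. (x a)\<^sup>2) = 2 * x b - (x b)\<^sup>2"
    using N x(1) by (simp add: sum_diff1)
  also have "\<dots> / (x b)\<^sup>2 = 2 / x b - 1"
    using xb by (simp add: diff_divide_distrib power2_eq_square)
  finally have sw: "1 + (\<Sum>a\<in>N. (w a)\<^sup>2) = 2 / x b" by simp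
  have "sphere_denom N b h = (1 + (\<Sum>a\<in>N. (w a)\<^sup>2)) / M\<^sup>2"
    using diff by (simp add: sphere_denom_def top power_divide sum_divide_distrib add_divide_distrib)
  then have den: "sphere_denom N b h = 2 / (x b * M\<^sup>2)" unfolding sw by simp
  have "sphere_coord N b h a = x a" if "a \<in> N" for a
    using diff[OF that] xb M by (auto simp: sphere_coord_def den top w_def field_simps power2_eq_square)
  then show ?thesis using h(1) total top M by (intro exI[of _ h]) auto
qed

lemma sphere_coord_cong:
  assumes "\<And>I. I \<subseteq> N \<Longrightarrow> h I = g I"
  shows "sphere_coord N b h = sphere_coord N b g"
proof -
  have "height N h = height N g" by (auto simp: height_def fun_eq_iff assms intro!: sum.cong)
  then show ?thesis by (simp add: sphere_coord_def sphere_denom_def assms fun_eq_iff)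
qed

text \<open>Coordinate blocks become fibres of division by \<open>n\<close>. The index
  \<open>a\<close> in \<open>{1..n}\<close> sits at position \<open>i * n + a - 1\<close>, so base
  index 1 is the first coordinate of its block.\<close>

lemma wedge_of_spheres_eq:
  assumes "n \<ge> 1"
  shows "wedge_of_spheres k (n - 1) = top_of_set (insert (\<lambda>_. 0) (\<Union>i<k. {x. (\<forall>j. j div n \<noteq> i \<longrightarrow> x j = 0) \<and>
     (\<Sum>a\<in>{1..n}. (x (i * n + a - 1))\<^sup>2) = 2 * x (i * n)}))"
proof -
  have block: "j \<in> {i * n..<(i + 1) * n} \<longleftrightarrow> j div n = i" for i j
    using assms by (auto simp: div_nat_eqI dividend_less_times_div mult.commute)
  have "(\<Sum>j\<in>{i * n..<(i + 1) * n}. (x j - (if j = i * n then 1 else 0))\<^sup>2) = 1 \<longleftrightarrow>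
      (\<Sum>a\<in>{1..n}. (x (i * n + a - 1))\<^sup>2) = 2 * x (i * n)" for i and x :: "nat \<Rightarrow> real"
  proof -
    have "(\<Sum>j\<in>{i * n..<(i + 1) * n}. (x j - (if j = i * n then 1 else 0))\<^sup>2)
        = (\<Sum>a\<in>{1..n}. (x (i * n + a - 1) - (if a = 1 then 1 else 0))\<^sup>2)"
      by (rule sum.reindex_bij_witness[of _ "\<lambda>a. i * n + a - 1" "\<lambda>j. j + 1 - i * n"]) auto
    also have "\<dots> = (\<Sum>a\<in>{1..n}. (x (i * n + a - 1))\<^sup>2 + (if a = 1 then 1 - 2 * x (i * n) else 0))"
      by (intro sum.cong) (auto simp: power2_diff)
    also have "\<dots> = (\<Sum>a\<in>{1..n}. (x (i * n + a - 1))\<^sup>2) + (1 - 2 * x (i * n))"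
      using assms by (simp add: sum.distrib)
    finally show ?thesis by linarith
  qed
  note sphere = this
  have n: "n - 1 + 1 = n" using assms by simp
  show ?thesis by (simp only: wedge_of_spheres_def n sphere block)
qed

section \<open>Collapsing onto the wedge\<close>

context full_diagram
begin

text \<open>Coordinates relative to the closed cell below \<open>(N, e)\<close>, defined for every
  point so that a single formula serves the whole realization.\<close>

definition face_weights :: "'b \<Rightarrow> (nat set \<times> 'b \<Rightarrow> real) \<Rightarrow> nat set \<Rightarrow> real" where
  "face_weights e f I = (if I = {} then 0 else f (I, r N I e))"

abbreviation realization :: "(nat set \<times> 'b \<Rightarrow> real) set" where
  "realization \<equiv> chain_points elements (inflation_le r)"

lemma chain_weights_face_weights:
  assumes "e \<in> D N" "f \<in> realization"
  shows "chain_weights N (face_weights e f)"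
  unfolding chain_weights_def
proof (intro conjI allI impI)
  fix I J assume IJ: "I \<subseteq> N" "J \<subseteq> N" "0 < face_weights e f I" "0 < face_weights e f J"
  then have "(I, r N I e) \<in> elements" "(J, r N J e) \<in> elements" "0 < f (I, r N I e)" "0 < f (J, r N J e)"
    using restr_in[OF _ subset_refl assms(1)] by (auto simp: face_weights_def split: if_splits)
  then have "inflation_le r (I, r N I e) (J, r N J e) \<or> inflation_le r (J, r N J e) (I, r N I e)"
    using chain_points_comparable[OF assms(2), of "(I, r N I e)" "(J, r N J e)"] by simp
  then show "I \<subseteq> J \<or> J \<subseteq> I" by (auto simp: inflation_le_def)
qed (use assms in \<open>auto simp: face_weights_def chain_points_def\<close>)

text \<open>\<open>(N, e)\<close> is maximal, so anything comparable with it is one of its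
  restrictions.\<close>

lemma face_of_top:
  assumes N: "N \<noteq> {}" and e: "e \<in> D N" and f: "f \<in> realization" "0 < f (N, e)" and x: "0 < f x"
  shows "x \<in> elements \<and> snd x = r N (fst x) e"
proof -
  have xe: "x \<in> elements" using x f(1) chain_points_support[of f elements "inflation_le r" x] by auto
  have "inflation_le r x (N, e) \<or> inflation_le r (N, e) x"
    using chain_points_comparable[OF f(1), of x "(N, e)"] f(2) x by simp
  then show ?thesis
  proof
    assume "inflation_le r x (N, e)"
    then show ?thesis using xe by (simp add: inflation_le_def)
  next
    assume *: "inflation_le r (N, e) x"
    then have "fst x = N" using xe by (auto simp: inflation_le_def)
    then show ?thesis using * xe e by (auto simp: inflation_le_def restr_id)
  qed
qed

lemma sum_face_weights:
  assumes e: "e \<in> D N" and f: "f \<in> realization"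
    and below: "\<And>x. x \<in> elements \<Longrightarrow> snd x \<noteq> r N (fst x) e \<Longrightarrow> f x = 0"
  shows "sum (face_weights e f) (Pow N) = 1"
proof -
  let ?g = "\<lambda>I. (I, r N I e)"
  have "sum (face_weights e f) (Pow N) = (\<Sum>I\<in>Pow N - {{}}. f (?g I))"
    using finite_N by (intro sum.mono_neutral_cong_right) (auto simp: face_weights_def)
  also have "\<dots> = sum f (?g ` (Pow N - {{}}))"
    by (subst sum.reindex) (auto simp: inj_on_def)
  also have "\<dots> = sum f elements"
  proof (rule sum.mono_neutral_left)
    show "?g ` (Pow N - {{}}) \<subseteq> elements" using restr_in[OF _ subset_refl e] by auto
    show "\<forall>x\<in>elements - ?g ` (Pow N - {{}}). f x = 0"
    proof
      fix x assume "x \<in> elements - ?g ` (Pow N - {{}})"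
      then show "f x = 0" using below[of x] by (cases x) auto
    qed
  qed (rule finite_V)
  finally show ?thesis using f by (simp add: chain_points_def)
qed

text \<open>Outside the closed cell the denominator may vanish. The realization is therefore covered
  by two closed sets: where \<open>f (N, e) = 0\<close> the coordinate is constantly 0, and on the
  closed cell the total weight 1 keeps the denominator positive.\<close>

lemma continuous_on_sphere_coord_face_weights:
  assumes N: "b \<in> N" and e: "e \<in> D N"
  shows "continuous_on realization (\<lambda>f. sphere_coord N b (face_weights e f) a)"
proof -
  let ?Z = "realization \<inter> {f. f (N, e) = 0}"
  let ?B = "realization \<inter> (\<Inter>x\<in>{x\<in>elements. snd x \<noteq> r N (fst x) e}. {f. f x = 0})"
  have fw: "continuous_on S (\<lambda>f. face_weights e f I)" for S I
    by (cases "I = {}") (auto simp: face_weights_def continuous_on_apply)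
  have ht: "continuous_on S (\<lambda>f. height N (face_weights e f) c)" for S c
    unfolding height_def by (intro continuous_on_sum fw)
  have "realization = ?Z \<union> ?B"
  proof -
    have "f \<in> ?Z \<union> ?B" if f: "f \<in> realization" for f
    proof (cases "f (N, e) = 0")
      case False
      then have p: "0 < f (N, e)" using chain_points_pos_iff[OF f] by simp
      have "f x = 0" if "snd x \<noteq> r N (fst x) e" for x
      proof (rule ccontr)
        assume "f x \<noteq> 0"
        then have "0 < f x" using chain_points_pos_iff[OF f] by simp
        then show False using face_of_top[OF _ e f p, of x] N that by auto
      qed
      then show ?thesis using f by auto
    qed (use f in auto)
    then show ?thesis by blast
  qed
  moreover have "continuous_on (?Z \<union> ?B) (\<lambda>f. sphere_coord N b (face_weights e f) a)"
  proof (rule continuous_on_closed_Un)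
    show "closed ?Z" "closed ?B"
      by (intro closed_Int closed_chain_points closed_INT ballI closed_Collect_eq continuous_on_apply continuous_on_const)+
    have "sphere_coord N b (face_weights e f) a = 0" if "f \<in> ?Z" for f
      using that N e restr_id[of N e] by (auto simp: sphere_coord_def face_weights_def)
    then show "continuous_on ?Z (\<lambda>f. sphere_coord N b (face_weights e f) a)"
      by (subst continuous_on_cong[OF refl, where g = "\<lambda>_. 0"]) auto
    have "sphere_denom N b (face_weights e f) \<noteq> 0" if f: "f \<in> ?B" for f
    proof -
      have "sum (face_weights e f) (Pow N) = 1"
      proof (rule sum_face_weights[OF e])
        show "f \<in> realization" using f by blast
        show "f x = 0" if "x \<in> elements" "snd x \<noteq> r N (fst x) e" for x using f that by blast
      qed
      then show ?thesis
        using sphere_denom_pos[OF finite_N N chain_weights_face_weights[OF e]] f by fastforce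
    qed
    moreover have "continuous_on ?B (\<lambda>f. sphere_denom N b (face_weights e f))"
      unfolding sphere_denom_def by (intro continuous_intros fw ht)
    ultimately show "continuous_on ?B (\<lambda>f. sphere_coord N b (face_weights e f) a)"
      unfolding sphere_coord_def
      by (cases "a = b") (auto intro!: continuous_on_divide continuous_on_mult continuous_on_diff continuous_on_const fw ht)
  qed
  ultimately show ?thesis by simp
qed

lemma sphere_coord_base_pos:
  assumes N: "b \<in> N" and e: "e \<in> D N" and f: "f \<in> realization"
  shows "0 < f (N, e) \<longleftrightarrow> sphere_coord N b (face_weights e f) b \<noteq> 0"
    and "f (N, e) = 0 \<Longrightarrow> sphere_coord N b (face_weights e f) a = 0"
proof -
  have top: "face_weights e f N = f (N, e)" using N e restr_id[of N e] by (auto simp: face_weights_def)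
  have "0 \<le> f (N, e)" using f by (simp add: chain_points_def)
  moreover have "sphere_denom N b (face_weights e f) \<noteq> 0" if "0 < f (N, e)"
  proof -
    have "0 \<le> (\<Sum>a\<in>N. (height N (face_weights e f) a - height N (face_weights e f) b)\<^sup>2)"
      by (intro sum_nonneg) auto
    then have "0 < sphere_denom N b (face_weights e f)"
      using that unfolding sphere_denom_def top by (simp add: add_pos_nonneg)
    then show ?thesis by simp
  qed
  ultimately show "0 < f (N, e) \<longleftrightarrow> sphere_coord N b (face_weights e f) b \<noteq> 0"
    by (auto simp: sphere_coord_def top)
  show "f (N, e) = 0 \<Longrightarrow> sphere_coord N b (face_weights e f) a = 0"
    by (simp add: sphere_coord_def top)
qed

lemma realization_eqI:
  assumes N: "N \<noteq> {}" and e: "e \<in> D N" and f: "f \<in> realization" "0 < f (N, e)" and g: "g \<in> realization" "0 < g (N, e)"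
    and eq: "\<And>I. I \<subseteq> N \<Longrightarrow> face_weights e f I = face_weights e g I"
  shows "f = g"
proof
  fix x
  show "f x = g x"
  proof (cases "x \<in> elements \<and> snd x = r N (fst x) e")
    case True
    then obtain I where "x = (I, r N I e)" "I \<subseteq> N" "I \<noteq> {}" by (cases x) auto
    then show ?thesis using eq[of I] by (simp add: face_weights_def)
  next
    case False
    then have "\<not> 0 < f x" "\<not> 0 < g x" using face_of_top[OF N e f, of x] face_of_top[OF N e g, of x] by auto
    then show ?thesis using chain_points_pos_iff[OF f(1), of x] chain_points_pos_iff[OF g(1), of x] by simp
  qed
qed

lemma ex_face_weights:
  assumes e: "e \<in> D N" and h: "chain_weights N h" "sum h (Pow N) = 1"
  obtains f where "f \<in> realization" "\<And>I. I \<subseteq> N \<Longrightarrow> face_weights e f I = h I"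
    "\<And>x. snd x \<noteq> r N (fst x) e \<Longrightarrow> f x = 0"
proof -
  define f where "f = (\<lambda>x. if x \<in> elements \<and> snd x = r N (fst x) e then h (fst x) else 0)"
  let ?g = "\<lambda>I. (I, r N I e)"
  have fw: "face_weights e f I = h I" if "I \<subseteq> N" for I
    using that h(1) restr_in[OF that subset_refl e] by (auto simp: face_weights_def f_def chain_weights_def)
  have "f \<in> realization"
    unfolding chain_points_def
  proof (intro CollectI conjI allI impI ballI)
    show "0 \<le> f x" for x using h(1) by (auto simp: f_def chain_weights_def)
    show "f x = 0" if "x \<notin> elements" for x using that by (auto simp: f_def)
    have "sum f elements = sum f (?g ` (Pow N - {{}}))"
    proof (rule sum.mono_neutral_right)
      show "?g ` (Pow N - {{}}) \<subseteq> elements" using restr_in[OF _ subset_refl e] by auto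
      show "\<forall>x\<in>elements - ?g ` (Pow N - {{}}). f x = 0" by (auto simp: f_def)
    qed (rule finite_V)
    also have "\<dots> = (\<Sum>I\<in>Pow N - {{}}. f (?g I))"
      by (subst sum.reindex) (auto simp: inj_on_def)
    also have "\<dots> = sum h (Pow N)"
      using finite_N h(1) restr_in[OF _ subset_refl e]
      by (intro sum.mono_neutral_cong_left) (auto simp: f_def chain_weights_def)
    finally show "sum f elements = 1" using h(2) by simp
    fix x y assume xy: "x \<in> elements" "y \<in> elements" "0 < f x \<and> 0 < f y"
    then have s: "snd x = r N (fst x) e" "snd y = r N (fst y) e" "0 < h (fst x)" "0 < h (fst y)" "fst x \<subseteq> N" "fst y \<subseteq> N"
      by (auto simp: f_def split: if_splits)
    then have "fst x \<subseteq> fst y \<or> fst y \<subseteq> fst x" using h(1) by (auto simp: chain_weights_def)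
    then show "inflation_le r x y \<or> inflation_le r y x"
      using s e by (auto simp: inflation_le_def restr_restr)
  qed
  then show ?thesis using fw by (intro that[of f]) (auto simp: f_def)
qed

lemma realization_homotopy_equivalent_wedge:
  assumes N: "N = {1..n}" "n \<ge> 1" and E: "E \<subseteq> D N"
    and contr: "contractible (chain_points (elements - {N} \<times> E) (inflation_le r))"
    and v: "v \<in> elements - {N} \<times> E"
  shows "\<exists>k. top_of_set realization homotopy_equivalent_space wedge_of_spheres k (n - 1)"
proof -
  let ?T = "elements - {N} \<times> E"
  let ?KT = "chain_points ?T (inflation_le r)"
  let ?S = "\<lambda>i. {x. (\<forall>j. j div n \<noteq> i \<longrightarrow> x j = 0) \<and> (\<Sum>a\<in>{1..n}. (x (i * n + a - 1))\<^sup>2) = 2 * x (i * n)}"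
  have N1: "1 \<in> N" "N \<noteq> {}" "finite N" using N by auto
  define k where "k = card E"
  have "finite E" using E finite_D[of N] finite_subset by blast
  then obtain s where s: "bij_betw s {..<k} E"
    using ex_bij_betw_nat_finite unfolding k_def atLeast0LessThan by blast
  have sD: "s i \<in> D N" if "i < k" for i using s E that by (auto simp: bij_betw_def)
  \<comment> \<open>Block \<open>i\<close> carries the sphere coordinates of the cell of
    \<open>s i\<close>; the shift by 1 matches \<open>N = {1..n}\<close>.\<close>
  define q where "q = (\<lambda>f j. if j div n < k then sphere_coord N 1 (face_weights (s (j div n)) f) (j mod n + 1) else 0)"
  have q_block: "q f (i * n + a - 1) = sphere_coord N 1 (face_weights (s i) f) a" if "i < k" "a \<in> N" for f i a
  proof -
    have "i * n + a - 1 = i * n + (a - 1)" "a - 1 < n" using that N by auto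
    then have "(i * n + a - 1) div n = i" "(i * n + a - 1) mod n = a - 1" by auto
    then show ?thesis using that N by (auto simp: q_def)
  qed
  have q_base: "q f (i * n) = sphere_coord N 1 (face_weights (s i) f) 1" if "i < k" for f i
    using q_block[OF that N1(1)] by simp
  have q_zero: "q f j = 0" if "f \<in> realization" "j div n < k \<Longrightarrow> f (N, s (j div n)) = 0" for f j
    using that sphere_coord_base_pos(2)[OF N1(1) sD that(1)] by (simp add: q_def)
  have q_base_iff: "0 < f (N, s i) \<longleftrightarrow> q f (i * n) \<noteq> 0" if "f \<in> realization" "i < k" for f i
    using sphere_coord_base_pos(1)[OF N1(1) sD[OF that(2)] that(1)] q_base[OF that(2)] by simp
  have qc: "continuous_on realization q"
    unfolding q_def
  proof (rule continuous_on_coordinatewise_then_product)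
    fix j
    show "continuous_on realization
        (\<lambda>f. if j div n < k then sphere_coord N 1 (face_weights (s (j div n)) f) (j mod n + 1) else 0)"
    proof (cases "j div n < k")
      case True
      then show ?thesis using continuous_on_sphere_coord_face_weights[OF N1(1) sD[OF True]] by simp
    qed simp
  qed
  \<comment> \<open>Distinct elements over \<open>N\<close> are incomparable, so a point lies in at
    most one open cell and its image has at most one nonzero block.\<close>
  have unique: "i = i'" if "f \<in> realization" "f (N, s i) \<noteq> 0" "f (N, s i') \<noteq> 0" "i < k" "i' < k" for f i i'
  proof -
    have "s i = s i'"
      using chain_points_comparable[OF that(1-3)] sD that(4,5) restr_id[of N] by (auto simp: inflation_le_def)
    then show ?thesis using s that(4,5) by (auto simp: bij_betw_def inj_on_def)
  qed
  have T_iff: "f \<in> ?KT \<longleftrightarrow> f \<in> realization \<and> (\<forall>i<k. f (N, s i) = 0)" for f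
  proof -
    have "elements - ?T = (\<lambda>i. (N, s i)) ` {..<k}"
      using s E N1(2) by (auto simp: bij_betw_def)
    then show ?thesis using chain_points_subset_iff[OF finite_V, of ?T f "inflation_le r"] by auto
  qed
  have in_sphere: "q f \<in> ?S i" if f: "f \<in> realization" and i: "i < k" "0 < f (N, s i)" for f i
  proof -
    have "q f j = 0" if "j div n \<noteq> i" for j
      by (rule q_zero[OF f]) (use unique[OF f, of i "j div n"] that i in auto)
    moreover have "(\<Sum>a\<in>{1..n}. (q f (i * n + a - 1))\<^sup>2) = (\<Sum>a\<in>N. (sphere_coord N 1 (face_weights (s i) f) a)\<^sup>2)"
      unfolding N(1)[symmetric] using q_block[OF i(1)] by (intro sum.cong) auto
    moreover have "face_weights (s i) f N = f (N, s i)"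
      using N1(2) sD[OF i(1)] restr_id[of N] by (simp add: face_weights_def)
    ultimately show ?thesis
      using sphere_coord_on_sphere[OF N1(3,1), of "face_weights (s i) f"] i q_base[OF i(1)] by auto
  qed
  have q_T: "q f = (\<lambda>_. 0)" if "f \<in> ?KT" for f
    using that q_zero[of f] T_iff by auto
  have q_sub: "q f \<in> insert (\<lambda>_. 0) (\<Union>i<k. ?S i)" if f: "f \<in> realization" for f
  proof (cases "f \<in> ?KT")
    case False
    then obtain i where "i < k" "0 < f (N, s i)" using T_iff f chain_points_pos_iff[OF f] by auto
    then show ?thesis using in_sphere[OF f] by blast
  qed (use q_T in simp)
  \<comment> \<open>A preimage of the wedge point. Contractibility alone would not provide one,
    since the empty set counts as contractible.\<close>
  have vT: "(\<lambda>x. if x = v then 1 else 0) \<in> ?KT"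
    using v finite_V le_refl by (intro chain_points_vertex) auto
  have q_sup: "w \<in> q ` realization" if w: "w \<in> insert (\<lambda>_. 0) (\<Union>i<k. ?S i)" for w
  proof (cases "w = (\<lambda>_. 0)")
    case True
    have "q (\<lambda>x. if x = v then 1 else 0) \<in> q ` realization" using T_iff vT by blast
    then show ?thesis unfolding True q_T[OF vT] .
  next
    case False
    then obtain i where i: "i < k" and wi: "w \<in> ?S i" using w by auto
    obtain j where j: "w j \<noteq> 0" using False by auto
    then have ji: "j div n = i" using wi by auto
    let ?x = "\<lambda>a. w (i * n + a - 1)"
    have jx: "?x (j mod n + 1) = w j" "j mod n + 1 \<in> N"
      using ji N by (auto simp: Suc_le_eq)
    have "(\<Sum>a\<in>N. (?x a)\<^sup>2) = 2 * ?x 1" using wi N(1) by simp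
    moreover have "\<exists>a\<in>N. ?x a \<noteq> 0" using jx j by metis
    ultimately obtain h where h: "chain_weights N h" "sum h (Pow N) = 1" "0 < h N" "\<And>a. a \<in> N \<Longrightarrow> sphere_coord N 1 h a = ?x a"
      using sphere_coord_surj[OF N1(3,1), of ?x] by blast
    obtain f where f: "f \<in> realization" "\<And>I. I \<subseteq> N \<Longrightarrow> face_weights (s i) f I = h I"
      "\<And>x. snd x \<noteq> r N (fst x) (s i) \<Longrightarrow> f x = 0"
      using ex_face_weights[OF sD[OF i] h(1,2)] by blast
    have sc: "sphere_coord N 1 (face_weights (s i) f) = sphere_coord N 1 h"
      by (rule sphere_coord_cong) (rule f(2))
    have "q f j' = w j'" for j'
    proof (cases "j' div n = i")
      case True
      let ?a = "j' mod n + 1"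
      have a: "i * n + ?a - 1 = j'" "?a \<in> N"
        using True N by (auto simp: Suc_le_eq)
      have "q f (i * n + ?a - 1) = w (i * n + ?a - 1)"
        unfolding q_block[OF i a(2)] sc by (rule h(4)[OF a(2)])
      then show ?thesis unfolding a(1) .
    next
      case False
      have "q f j' = 0"
      proof (rule q_zero[OF f(1)])
        assume l: "j' div n < k"
        then have "s (j' div n) \<noteq> s i" using s False i by (auto simp: bij_betw_def inj_on_def)
        then show "f (N, s (j' div n)) = 0" using f(3)[of "(N, s (j' div n))"] sD[OF i] restr_id[of N] by simp
      qed
      then show ?thesis using wi False by auto
    qed
    then have "q f = w" by auto
    then show ?thesis using f(1) by blast
  qed
  have fibre: "f = g \<or> f \<in> ?KT \<and> g \<in> ?KT" if f: "f \<in> realization" and g: "g \<in> realization" and eq: "q f = q g" for f g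
  proof (cases "\<exists>i<k. 0 < f (N, s i)")
    case False
    then have "\<not> (\<exists>i<k. 0 < g (N, s i))" using q_base_iff[OF f] q_base_iff[OF g] eq by auto
    then show ?thesis using False f g T_iff chain_points_pos_iff[OF f] chain_points_pos_iff[OF g] by auto
  next
    case True
    then obtain i where i: "i < k" "0 < f (N, s i)" by blast
    then have gi: "0 < g (N, s i)" using q_base_iff[OF f i(1)] q_base_iff[OF g i(1)] eq by simp
    have props: "chain_weights N (face_weights (s i) f)" "sum (face_weights (s i) f) (Pow N) = 1" "0 < face_weights (s i) f N"
      if "f \<in> realization" "0 < f (N, s i)" for f
    proof -
      show "chain_weights N (face_weights (s i) f)" using chain_weights_face_weights[OF sD[OF i(1)] that(1)] .
      show "sum (face_weights (s i) f) (Pow N) = 1"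
      proof (rule sum_face_weights[OF sD[OF i(1)] that(1)])
        fix x assume "snd x \<noteq> r N (fst x) (s i)"
        then show "f x = 0"
          using face_of_top[OF N1(2) sD[OF i(1)] that, of x] chain_points_pos_iff[OF that(1), of x] by auto
      qed
      show "0 < face_weights (s i) f N"
        using that N1(2) sD[OF i(1)] restr_id[of N] by (simp add: face_weights_def)
    qed
    have "face_weights (s i) f I = face_weights (s i) g I" if "I \<subseteq> N" for I
    proof (rule sphere_coord_inj[OF N1(3,1) props[OF f i(2)] props[OF g gi] _ that])
      fix a assume "a \<in> N"
      then show "sphere_coord N 1 (face_weights (s i) f) a = sphere_coord N 1 (face_weights (s i) g) a"
        using q_block[OF i(1)] eq by metis
    qed
    then show ?thesis using realization_eqI[OF N1(2) sD[OF i(1)] f i(2) g gi] by blast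
  qed
  have KT_sub: "?KT \<subseteq> realization" using T_iff by blast
  obtain H :: "real \<times> (nat set \<times> 'b \<Rightarrow> real) \<Rightarrow> nat set \<times> 'b \<Rightarrow> real" and a where H: "continuous_on ({0..1} \<times> ?KT) H" "H ` ({0..1} \<times> ?KT) \<subseteq> ?KT"
    "\<And>f. H (0, f) = f" "\<And>f. H (1, f) = a"
  proof -
    obtain a where "homotopic_with_canon (\<lambda>x. True) ?KT ?KT id (\<lambda>x. a)"
      using contr by (auto simp: contractible_def)
    then obtain H :: "real \<times> (nat set \<times> 'b \<Rightarrow> real) \<Rightarrow> nat set \<times> 'b \<Rightarrow> real" where
      "continuous_map (prod_topology (top_of_set {0..1}) (top_of_set ?KT)) (top_of_set ?KT) H"
      "\<And>f. H (0, f) = f" "\<And>f. H (1, f) = a"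
      unfolding homotopic_with_def by auto
    then show ?thesis
      by (intro that[of H a]) (simp_all add: subtopology_Times[symmetric] image_subset_iff_funcset)
  qed
  obtain G where G: "continuous_on ({0..1} \<times> realization) G" "G ` ({0..1} \<times> realization) \<subseteq> realization"
    "\<And>f. f \<in> realization \<Longrightarrow> G (0, f) = f"
    "\<And>t f. t \<in> {0..1} \<Longrightarrow> f \<in> ?KT \<Longrightarrow> G (t, f) = H (t, f)"
  proof (rule chain_points_homotopy_extension[OF finite_V, of ?T "inflation_le r" id realization H])
    show "H ` ({0..1} \<times> ?KT) \<subseteq> realization" using H(2) KT_sub by blast
  qed (use H in auto)
  have wedge: "wedge_of_spheres k (n - 1) = top_of_set (insert (\<lambda>_. 0) (\<Union>i<k. ?S i))" (is "_ = top_of_set ?W")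
    using wedge_of_spheres_eq[OF N(2)] .
  have "top_of_set realization homotopy_equivalent_space top_of_set ?W"
  proof (rule homotopy_equivalent_space_collapse[where T = ?KT and q = q and h = G])
    show "compact_space (top_of_set realization)"
      using compact_chain_points[OF finite_V] by (simp add: compact_space_subtopology)
    show "Hausdorff_space (top_of_set ?W)" by (intro Hausdorff_space_subtopology) simp
    show "continuous_map (top_of_set realization) (top_of_set ?W) q"
      using qc q_sub by auto
    show "q ` topspace (top_of_set realization) = topspace (top_of_set ?W)"
      unfolding topspace_euclidean_subtopology using q_sub q_sup by (intro subset_antisym image_subsetI subsetI)
    show "continuous_map (prod_topology (top_of_set {0..1}) (top_of_set realization)) (top_of_set realization) G"
      using G(1,2) by (simp add: subtopology_Times[symmetric] image_subset_iff_funcset)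
    show "G (t, f) \<in> ?KT" if "t \<in> {0..1}" "f \<in> ?KT" for t f
      using G(4)[OF that] H(2) that by auto
    show "G (1, f) = a" if "f \<in> ?KT" for f using G(4)[OF _ that, of 1] H(4) by simp
  qed (use fibre q_T G(3) in auto)
  then show ?thesis unfolding wedge[symmetric] by blast
qed

theorem realization_wedge_of_spheres:
  assumes N: "N = {1..n}" "n \<ge> 1"
  shows "\<exists>k. top_of_set realization homotopy_equivalent_space wedge_of_spheres k (n - 1)"
proof (rule realization_homotopy_equivalent_wedge[OF N, of "snd ` essential" "apex 1"])
  have 1: "1 \<in> N" using N by auto
  have eq: "{N} \<times> snd ` essential = essential" using essential_top by force
  show "snd ` essential \<subseteq> D N"
  proof (rule image_subsetI)
    fix x assume x: "x \<in> essential"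
    then have "x \<in> elements" unfolding essential_def by blast
    then show "snd x \<in> D N" using essential_top[OF x] by (cases x) simp
  qed
  show "contractible (chain_points (elements - {N} \<times> snd ` essential) (inflation_le r))"
    unfolding eq using contractible_inessential 1 by blast
  show "apex 1 \<in> elements - {N} \<times> snd ` essential"
    unfolding eq unfolding essential_def
    by (intro DiffI apex_in_elements[OF 1] notI) (erule DiffD2, rule UN_I[OF 1 apex_in_cone[OF 1]])
qed

end

text \<open>The nonempty subsets of \<open>J\<close> form an open set, and removing \<open>J\<close>
  leaves an open set whose sections are the compatible families below \<open>J\<close>. Flabbiness
  extends such a section, and its value at \<open>J\<close> is the lift.\<close>

lemma full_diagramI:
  fixes D :: "nat set \<Rightarrow> 'b set"
  assumes diagram: "is_diagram (face_poset n) D r"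
    and inhabited: "sheaf_inhabited (face_poset n) D r" and flabby: "sheaf_flabby (face_poset n) D r"
  shows "full_diagram {1..n} (\<lambda>I. if I = {} then {undefined} else D I)
     (\<lambda>J I e. if I = {} then undefined else r J I e) undefined"
    (is "full_diagram _ ?D ?r _")
proof
  have P: "I \<in> face_poset n \<longleftrightarrow> I \<subseteq> {1..n} \<and> I \<noteq> {}" for I by (auto simp: face_poset_def)
  show "finite (?D I)" if "I \<subseteq> {1..n}" for I
    using that diagram by (auto simp: is_diagram_def P)
  show "?r J I e \<in> ?D I" if "I \<subseteq> J" "J \<subseteq> {1..n}" "e \<in> ?D J" for I J e
    using that diagram P[of I] P[of J] by (auto simp: is_diagram_def split: if_splits)
  show "?r I I e = e" if "I \<subseteq> {1..n}" "e \<in> ?D I" for I e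
    using that diagram P[of I] by (auto simp: is_diagram_def split: if_splits)
  show "?r J I (?r K J e) = ?r K I e" if "I \<subseteq> J" "J \<subseteq> K" "K \<subseteq> {1..n}" "e \<in> ?D K" for I J K e
  proof (cases "I = {}")
    case False
    then have "I \<in> face_poset n" "J \<in> face_poset n" "K \<in> face_poset n" "J \<noteq> {}" "K \<noteq> {}" using that P by auto
    then show ?thesis using that diagram False by (simp add: is_diagram_def)
  qed simp
  show "\<exists>e\<in>?D J. \<forall>I. I \<subset> J \<longrightarrow> ?r J I e = v I"
    if J: "J \<subseteq> {1..n}" "J \<noteq> {}" and v: "\<And>I. I \<subset> J \<Longrightarrow> v I \<in> ?D I"
      and compat: "\<And>I K. I \<subseteq> K \<Longrightarrow> K \<subset> J \<Longrightarrow> ?r K I (v K) = v I" for J v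
  proof -
    define U where "U = {I. I \<subseteq> J \<and> I \<noteq> {}}"
    have U: "alex_open (face_poset n) U" "alex_open (face_poset n) (U - {J})"
    proof -
      have "U \<subseteq> face_poset n" using J(1) P unfolding U_def by blast
      moreover have "I \<in> U" "I \<noteq> J \<Longrightarrow> I \<in> U - {J}" if "I \<in> face_poset n" "K \<in> U" "I \<subseteq> K" for I K
        using that P unfolding U_def by blast+
      moreover have "I \<noteq> J" if "K \<in> U - {J}" "I \<subseteq> K" for I K using that unfolding U_def by blast
      ultimately show "alex_open (face_poset n) U" "alex_open (face_poset n) (U - {J})"
        unfolding alex_open_def by blast+
    qed
    have JU: "J \<in> U" using J by (simp add: U_def)
    have "\<exists>s\<in>sections D r U. \<forall>I\<in>U - {J}. s I = v I"
    proof (cases "U - {J} = {}")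
      \<comment> \<open>For a singleton \<open>J\<close> the smaller open set is empty and
        flabbiness says nothing; inhabitedness supplies the section.\<close>
      case True
      have "sections D r U \<noteq> {}" using inhabited U(1) JU unfolding sheaf_inhabited_def by blast
      then show ?thesis unfolding True by auto
    next
      case False
      have "restrict v (U - {J}) \<in> sections D r (U - {J})"
        unfolding sections_def
      proof (intro CollectI conjI ballI allI impI)
        fix I assume "I \<in> U - {J}"
        then show "restrict v (U - {J}) I \<in> D I" using v[of I] by (auto simp: U_def)
      next
        fix I K assume IK: "I \<in> U - {J}" "K \<in> U - {J}" "I \<subseteq> K"
        then show "r K I (restrict v (U - {J}) K) = restrict v (U - {J}) I"
          using compat[of I K] by (auto simp: U_def)
      qed auto
      also have "sections D r (U - {J}) = (\<lambda>s. restrict s (U - {J})) ` sections D r U"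
        using flabby U False by (auto simp: sheaf_flabby_def)
      finally obtain s where s: "s \<in> sections D r U" "restrict v (U - {J}) = restrict s (U - {J})" by blast
      have "s I = v I" if "I \<in> U - {J}" for I using fun_cong[OF s(2), of I] that by simp
      then show ?thesis using s(1) by blast
    qed
    then obtain s where s: "s \<in> sections D r U" "\<And>I. I \<in> U - {J} \<Longrightarrow> s I = v I" by blast
    show ?thesis
    proof (intro bexI[of _ "s J"] allI impI)
      show "s J \<in> ?D J" using s(1) JU J by (auto simp: sections_def)
      fix I assume I: "I \<subset> J"
      show "?r J I (s J) = v I"
      proof (cases "I = {}")
        case True
        then show ?thesis using v[OF I] by simp
      next
        case False
        then have "I \<in> U - {J}" using I by (auto simp: U_def)
        then show ?thesis using s JU I False by (auto simp: sections_def)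
      qed
    qed
  qed
qed auto

theorem theorem5p1:
  fixes n :: nat
    and D :: "nat set \<Rightarrow> 'b set"
    and r :: "nat set \<Rightarrow> nat set \<Rightarrow> 'b \<Rightarrow> 'b"
  assumes "n \<ge> 1"
    and "is_diagram (face_poset n) D r"
    and "sheaf_inhabited (face_poset n) D r"
    and "sheaf_flabby (face_poset n) D r"
  shows "\<exists>k. order_complex_realization (inflation_set (face_poset n) D) (inflation_le r)
               homotopy_equivalent_space wedge_of_spheres k (n - 1)"
proof -
  let ?D = "\<lambda>I. if I = {} then {undefined} else D I"
  let ?r = "\<lambda>J I e. if I = {} then undefined else r J I e"
  interpret full_diagram "{1..n}" ?D ?r undefined
    using full_diagramI[OF assms(2-4)] .
  have V: "inflation_set (face_poset n) D = elements"
    by (auto simp: inflation_set_def face_poset_def split: if_splits)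
  \<comment> \<open>The two systems of restrictions differ only when the target index is empty,
    which no element has.\<close>
  have le: "inflation_le ?r x y = inflation_le r x y" if "x \<in> elements" for x y
    using that by (auto simp: inflation_le_def)
  have "order_complex_realization elements (inflation_le r) = top_of_set realization"
    unfolding order_complex_realization_def chain_points_def using le by (intro arg_cong[of _ _ top_of_set] Collect_cong) blast
  then show ?thesis unfolding V using realization_wedge_of_spheres[OF refl assms(1)] by simp
qed

end
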